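(* Let $g\ge 2$ be an integer, $\epsilon>0$, and $\mathfrak{m}\in\mathbb{Z}$. Let $\Delta_g(\cdot,\mathfrak{m})$ be the tempered distribution on $\mathbb{R}$ given by $$\Delta_g(\phi_0,\mathfrak{m})=-\frac{1}{(2g-3)!}\,\frac{d^{2g-3}}{d\phi_0^{2g-3}}\left(\operatorname{pv}\frac{1}{\phi_0}+i\pi\,\operatorname{sign}(\mathfrak{m})\,\delta(\phi_0)\right).$$ Then, with $H=H_{g,\epsilon}$ the function defined in the context, $$H(|\mathfrak{m}|)=\int_{-\infty}^{+\infty}d\phi_0\;e^{-\epsilon\phi_0^2-2\pi i\mathfrak{m}\phi_0}\;\Delta_g(\phi_0,\mathfrak{m}),$$ where the right-hand side denotes the pairing of the tempered distribution $\Delta_g(\cdot,\mathfrak{m})$ with the Schwartz function $\phi_0\mapsto e^{-\epsilon\phi_0^2-2\pi i\mathfrak{m}\phi_0}$.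
   Context: $\operatorname{pv}\frac1x$ is the Cauchy principal value distribution, $\delta$ is the Dirac delta, derivatives are in the sense of distributions, and $\operatorname{sign}(0)=0$. $n!!$ is the double factorial, with $(-1)!!=1$. $\operatorname{erfc}(x)=1-\operatorname{erf}(x)=\frac{2}{\sqrt\pi}\int_x^\infty e^{-t^2}\,dt$. $H_n(x)$ denotes the physicists' Hermite polynomials, with generating function $e^{2xt-t^2}=\sum_{n\ge0}H_n(x)\,t^n/n!$; note that $H_n$ with an index denotes a Hermite polynomial, whereas $H$ (that is, $H_{g,\epsilon}$) denotes the function below. For given $g\ge2$ and $\epsilon>0$, define for real $p$ $$H(p)=e^{-\pi^2p^2/\epsilon}\,P(p)-\operatorname{erfc}\!\big(\pi p/\sqrt{\epsilon}\big)\,Q'(p),$$ where $P$ is the even polynomial $$P(p)=(-1)^{g-1}(2\pi)^{2g-3}\sqrt{\frac{\epsilon}{\pi}}\sum_{k=0}^{g-2}\Big(-\frac{\epsilon}{2\pi^2}\Big)^{k}p^{2g-4-2k}\sum_{m=0}^{k}\frac{(-1)^m\,(2k-2m-1)!!}{2^m\,m!\,(2g-2m-3)!},$$ and $Q'$ is the odd real polynomial $$Q'(p)=\frac{i\pi\,\epsilon^{g-\frac32}}{(2g-3)!}\,H_{2g-3}\!\Big(\frac{i\pi p}{\sqrt{\epsilon}}\Big).$$ *)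

theory Defs
  imports "HOL-Complex_Analysis.Complex_Analysis"
begin

section \<open>Schwartz functions and tempered distributions on the real line\<close>

definition nth_deriv :: "nat \<Rightarrow> (real \<Rightarrow> complex) \<Rightarrow> real \<Rightarrow> complex" where
  "nth_deriv n f = ((\<lambda>h x. vector_derivative h (at x)) ^^ n) f"

definition schwartz :: "(real \<Rightarrow> complex) \<Rightarrow> bool" where
  "schwartz f \<longleftrightarrow>
     (\<forall>n x. nth_deriv n f differentiable at x) \<and>
     (\<forall>k n. bounded (range (\<lambda>x. complex_of_real (x ^ k) * nth_deriv n f x)))"

definition schwartz_seminorm :: "nat \<Rightarrow> nat \<Rightarrow> (real \<Rightarrow> complex) \<Rightarrow> real" where
  "schwartz_seminorm k n f = (SUP x. norm (complex_of_real (x ^ k) * nth_deriv n f x))"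

text \<open>A distribution is represented by its pairing with test functions, so that \<open>T f\<close> is the
  pairing of \<open>T\<close> with \<open>f\<close>. Only the values on Schwartz functions are meaningful.\<close>

type_synonym functional = "(real \<Rightarrow> complex) \<Rightarrow> complex"

definition tempered_distribution :: "functional \<Rightarrow> bool" where
  "tempered_distribution T \<longleftrightarrow>
     (\<forall>f h. schwartz f \<longrightarrow> schwartz h \<longrightarrow> T (\<lambda>x. f x + h x) = T f + T h) \<and>
     (\<forall>c f. schwartz f \<longrightarrow> T (\<lambda>x. c * f x) = c * T f) \<and>
     (\<exists>C N. \<forall>f. schwartz f \<longrightarrow>
        norm (T f) \<le> C * (\<Sum>k\<le>N. \<Sum>n\<le>N. schwartz_seminorm k n f))"

definition dist_deriv :: "functional \<Rightarrow> functional" where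
  "dist_deriv T = (\<lambda>f. - T (\<lambda>x. vector_derivative f (at x)))"

definition dirac_delta :: functional where
  "dirac_delta f = f 0"

definition pv_inverse :: functional where
  "pv_inverse f =
     Lim (at_right 0) (\<lambda>r. LINT x:{x. r < \<bar>x\<bar>}|lborel. f x / complex_of_real x)"

definition Delta :: "nat \<Rightarrow> int \<Rightarrow> functional" where
  "Delta g m = (\<lambda>f. - (1 / fact (2 * g - 3)) *
     (dist_deriv ^^ (2 * g - 3))
       (\<lambda>h. pv_inverse h + \<i> * complex_of_real pi * of_int (sgn m) * dirac_delta h) f)"


section \<open>Special functions\<close>

definition erfc :: "real \<Rightarrow> real" where
  "erfc x = 2 / sqrt pi * (LINT t:{x..}|lborel. exp (- t\<^sup>2))"

text \<open>Integer argument, so that \<open>(-1)!! = 1\<close> is the empty product.\<close>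

definition double_fact :: "int \<Rightarrow> int" where
  "double_fact n = \<Prod>{j \<in> {1..n}. even (n - j)}"

text \<open>Physicists' Hermite polynomials, as Taylor coefficients of the generating function.\<close>

definition hermite :: "nat \<Rightarrow> complex \<Rightarrow> complex" where
  "hermite n x = (deriv ^^ n) (\<lambda>t. exp (2 * x * t - t\<^sup>2)) 0"

lemma hermite_generating_function:
  "(\<lambda>n. hermite n x * t ^ n / fact n) sums exp (2 * x * t - t\<^sup>2)"
proof -
  have "(\<lambda>t. exp (2 * x * t - t\<^sup>2)) holomorphic_on ball 0 (norm t + 1)"
    by (intro holomorphic_intros)
  from holomorphic_power_series[OF this, of t] show ?thesis
    by (simp add: hermite_def)
qed


section \<open>The function \<open>H\<close>\<close>

text \<open>All natural-number subtractions below are exact for \<open>g \<ge> 2\<close>.\<close>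

definition P_fun :: "nat \<Rightarrow> real \<Rightarrow> real \<Rightarrow> real" where
  "P_fun g \<epsilon> p = (-1) ^ (g - 1) * (2 * pi) ^ (2 * g - 3) * sqrt (\<epsilon> / pi) *
     (\<Sum>k = 0..g - 2. (- (\<epsilon> / (2 * pi\<^sup>2))) ^ k * p ^ (2 * g - 4 - 2 * k) *
       (\<Sum>m = 0..k. (-1) ^ m * of_int (double_fact (2 * int k - 2 * int m - 1)) /
          (2 ^ m * fact m * fact (2 * g - 2 * m - 3))))"

text \<open>\<open>Q'_fun\<close> and \<open>H_fun\<close> take real values, but the formula for \<open>Q'_fun\<close> involves a Hermite
  polynomial at an imaginary argument.\<close>

definition Q'_fun :: "nat \<Rightarrow> real \<Rightarrow> real \<Rightarrow> complex" where
  "Q'_fun g \<epsilon> p =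
     \<i> * complex_of_real (pi * \<epsilon> powr (real g - 3 / 2)) / fact (2 * g - 3) *
     hermite (2 * g - 3) (\<i> * complex_of_real (pi * p / sqrt \<epsilon>))"

definition H_fun :: "nat \<Rightarrow> real \<Rightarrow> real \<Rightarrow> complex" where
  "H_fun g \<epsilon> p = complex_of_real (exp (- (pi\<^sup>2 * p\<^sup>2 / \<epsilon>)) * P_fun g \<epsilon> p) -
     complex_of_real (erfc (pi * p / sqrt \<epsilon>)) * Q'_fun g \<epsilon> p"

end

theory Submission
  imports Defs "HOL-Probability.Probability"
begin

text \<open>Write \<open>n = 2g - 3\<close>, \<open>t = -2\<pi>m\<close> and \<open>v(x) = i t - 2\<epsilon>x\<close>, so that \<open>\<psi>' = v \<psi>\<close>. The derivative
  \<open>\<psi>\<^sup>(\<^sup>n\<^sup>)\<close> is a Hermite polynomial in \<open>v\<close> times \<open>\<psi>\<close>, so it suffices to pair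
  \<open>T = pv 1/x + i\<pi> sgn m \<delta>\<close> with \<open>v\<^sup>j \<psi>\<close>. As \<open>x T = 1\<close>, these pairings obey
  \<open>T(v\<^sup>j\<^sup>+\<^sup>1 \<psi>) = i t T(v\<^sup>j \<psi>) - 2\<epsilon> \<integral> v\<^sup>j \<psi>\<close>, and the moments on the right follow from
  \<open>\<integral> \<psi>\<close> by integration by parts. The powers of \<open>i t\<close> multiplying \<open>T(\<psi>)\<close>, which is an \<open>erfc\<close>, sum up to
  the Hermite polynomial in \<open>Q'\<close>; the moments give the double sum in \<open>P\<close>.\<close>

section \<open>The principal value on Schwartz functions\<close>

lemma nth_deriv_0 [simp]: "nth_deriv 0 f = f"
  by (simp add: nth_deriv_def)

lemma nth_deriv_Suc: "nth_deriv (Suc n) f = (\<lambda>x. vector_derivative (nth_deriv n f) (at x))"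
  by (simp add: nth_deriv_def)

lemma nth_deriv_add: "nth_deriv m (nth_deriv n f) = nth_deriv (m + n) f"
  by (simp add: nth_deriv_def funpow_add)

lemma schwartz_nth_deriv: "schwartz f \<Longrightarrow> schwartz (nth_deriv n f)"
  by (simp add: schwartz_def nth_deriv_add)

lemma schwartz_seminorm_nth_deriv:
  "schwartz_seminorm k j (nth_deriv n f) = schwartz_seminorm k (j + n) f"
  by (simp add: schwartz_seminorm_def nth_deriv_add)

lemma schwartz_has_vector_derivative:
  "schwartz f \<Longrightarrow> (nth_deriv n f has_vector_derivative nth_deriv (Suc n) f x) (at x)"
  unfolding nth_deriv_Suc schwartz_def by (simp add: vector_derivative_works)

lemma schwartz_has_vector_derivative_0:
  "schwartz f \<Longrightarrow> (f has_vector_derivative nth_deriv 1 f x) (at x)"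
  using schwartz_has_vector_derivative[of f 0 x] by simp

lemma schwartz_isCont: "schwartz f \<Longrightarrow> isCont f x"
  using schwartz_has_vector_derivative_0 has_vector_derivative_continuous by blast

lemma schwartz_measurable: "schwartz f \<Longrightarrow> f \<in> borel_measurable borel"
  by (intro borel_measurable_continuous_onI continuous_at_imp_continuous_on ballI schwartz_isCont)

lemma schwartz_seminorm_ge:
  assumes "schwartz f"
  shows "norm (complex_of_real (x ^ k) * nth_deriv n f x) \<le> schwartz_seminorm k n f"
proof -
  have "bounded (range (\<lambda>x. complex_of_real (x ^ k) * nth_deriv n f x))"
    using assms by (simp add: schwartz_def)
  then have "bdd_above (range (\<lambda>x. norm (complex_of_real (x ^ k) * nth_deriv n f x)))"
    by (auto simp: bounded_iff bdd_above_def)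
  then show ?thesis
    unfolding schwartz_seminorm_def by (rule cSUP_upper2[of _ _ x]) auto
qed

lemma schwartz_seminorm_nonneg: "schwartz f \<Longrightarrow> 0 \<le> schwartz_seminorm k n f"
  using order_trans[OF norm_ge_zero schwartz_seminorm_ge] .

lemma nth_deriv_plus:
  assumes "schwartz f" "schwartz h"
  shows "nth_deriv n (\<lambda>x. f x + h x) = (\<lambda>x. nth_deriv n f x + nth_deriv n h x)"
proof (induction n)
  case (Suc n)
  show ?case
    unfolding nth_deriv_Suc Suc using assms
    by (intro ext vector_derivative_at has_vector_derivative_add)
       (auto simp: schwartz_def vector_derivative_works[symmetric])
qed simp

lemma nth_deriv_cmult:
  assumes "schwartz f"
  shows "nth_deriv n (\<lambda>x. c * f x) = (\<lambda>x. c * nth_deriv n f x)"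
proof (induction n)
  case (Suc n)
  show ?case
    unfolding nth_deriv_Suc Suc using assms
    by (intro ext vector_derivative_at has_vector_derivative_mult_right)
       (auto simp: schwartz_def vector_derivative_works[symmetric])
qed simp

lemma integrable_cauchy_density: "integrable lborel (\<lambda>x::real. 1 / (1 + x\<^sup>2))"
  using integrable_inverse_1_plus_square by (simp add: set_integrable_def inverse_eq_divide)

lemma integral_cauchy_density: "(LINT x|lborel. 1 / (1 + x\<^sup>2)) = pi"
  using LBINT_inverse_1_plus_square
  by (simp add: interval_lebesgue_integral_def set_lebesgue_integral_def inverse_eq_divide)

text \<open>The seminorms of orders 0 and 2 in \<open>x\<close> together bound
  \<open>(1 + x\<^sup>2) * norm (f x)\<close>, so a multiple of the Cauchy density is an integrable
  majorant.\<close>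

lemma schwartz_integrable:
  assumes "schwartz f"
  shows "integrable lborel f"
proof (rule Bochner_Integration.integrable_bound)
  let ?C = "schwartz_seminorm 0 0 f + schwartz_seminorm 2 0 f"
  show "integrable lborel (\<lambda>x. ?C * (1 / (1 + x\<^sup>2)))"
    by (intro integrable_mult_right integrable_cauchy_density)
  show "f \<in> borel_measurable lborel"
    using schwartz_measurable[OF assms] by simp
  show "AE x in lborel. norm (f x) \<le> norm (?C * (1 / (1 + x\<^sup>2)))"
  proof (rule AE_I2)
    fix x
    have "norm (f x) * (1 + x\<^sup>2) \<le> ?C"
      using schwartz_seminorm_ge[OF assms, of x 0 0] schwartz_seminorm_ge[OF assms, of x 2 0]
      by (simp add: norm_mult norm_power algebra_simps)
    moreover have "0 < 1 + x\<^sup>2" by (simp add: add_pos_nonneg)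
    ultimately have "norm (f x) \<le> ?C / (1 + x\<^sup>2)"
      by (simp add: pos_le_divide_eq)
    also have "\<dots> \<le> norm (?C * (1 / (1 + x\<^sup>2)))"
      using abs_ge_self[of "?C * (1 / (1 + x\<^sup>2))"] by simp
    finally show "norm (f x) \<le> norm (?C * (1 / (1 + x\<^sup>2)))" .
  qed
qed

lemma schwartz_tendsto_0:
  assumes "schwartz f"
  shows "(f \<longlongrightarrow> 0) at_infinity"
proof (rule Lim_null_comparison)
  let ?C = "schwartz_seminorm 1 0 f"
  show "\<forall>\<^sub>F x in at_infinity. norm (f x) \<le> ?C * inverse (norm x)"
    unfolding eventually_at_infinity
  proof (intro exI[of _ 1] allI impI)
    fix x :: real assume "1 \<le> norm x"
    then show "norm (f x) \<le> ?C * inverse (norm x)"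
      using schwartz_seminorm_ge[OF assms, of x 1 0]
      by (simp add: norm_mult field_simps)
  qed
  show "((\<lambda>x::real. ?C * inverse (norm x)) \<longlongrightarrow> 0) at_infinity"
    by (intro tendsto_mult_right_zero tendsto_inverse_0_at_top filterlim_norm_at_top)
qed

text \<open>Decay at both ends removes the boundary terms. This is the integration by parts behind
  the moment recursion \<open>moment_pderiv\<close>.\<close>

lemma integral_deriv_schwartz:
  assumes "schwartz f"
  shows "(LINT x|lborel. nth_deriv 1 f x) = 0"
proof -
  have "(LBINT x=-\<infinity>..\<infinity>. nth_deriv 1 f x) = 0 - 0"
  proof (rule interval_integral_FTC_integrable)
    show "set_integrable lborel (einterval (-\<infinity>) \<infinity>) (nth_deriv 1 f)"
      using schwartz_integrable[OF schwartz_nth_deriv[OF assms, of 1]]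
      by (simp add: set_integrable_def)
    show "((f \<circ> real_of_ereal) \<longlongrightarrow> 0) (at_right (- \<infinity>))" "((f \<circ> real_of_ereal) \<longlongrightarrow> 0) (at_left \<infinity>)"
      using schwartz_tendsto_0[OF assms]
      by (auto simp: ereal_tendsto_simps intro: tendsto_mono at_top_le_at_infinity at_bot_le_at_infinity)
  qed (use assms in \<open>auto simp del: One_nat_def intro: schwartz_has_vector_derivative_0 schwartz_isCont schwartz_nth_deriv\<close>)
  then show ?thesis
    by (simp add: interval_lebesgue_integral_def set_lebesgue_integral_def)
qed

section \<open>The principal value as an absolutely convergent integral\<close>

definition odd_quot :: "(real \<Rightarrow> complex) \<Rightarrow> real \<Rightarrow> complex" where
  "odd_quot f x = (f x - f (- x)) / (2 * complex_of_real x)"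

lemma schwartz_lipschitz:
  assumes "schwartz f"
  shows "norm (f x - f y) \<le> schwartz_seminorm 0 1 f * \<bar>x - y\<bar>"
proof -
  have "norm (f x - f y) \<le> schwartz_seminorm 0 1 f * norm (x - y)"
  proof (rule differentiable_bound[of UNIV])
    fix z
    show "(f has_derivative (\<lambda>h. h *\<^sub>R nth_deriv 1 f z)) (at z within UNIV)"
      using schwartz_has_vector_derivative_0[OF assms] by (simp add: has_vector_derivative_def)
    show "onorm (\<lambda>h. h *\<^sub>R nth_deriv 1 f z) \<le> schwartz_seminorm 0 1 f"
      using schwartz_seminorm_ge[OF assms, of z 0 1]
      by (intro onorm_le) (simp add: mult.commute mult_left_mono)
  qed auto
  then show ?thesis by simp
qed

text \<open>The Lipschitz bound controls the quotient near 0, and the decay of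
  \<open>x * f x\<close> controls \<open>x\<^sup>2\<close> times it; adding the two gives the Cauchy
  majorant. An explicit constant in seminorms is kept because it later yields the continuity of the
  principal value.\<close>

lemma norm_odd_quot_le:
  assumes "schwartz f"
  shows "norm (odd_quot f x) \<le>
    (schwartz_seminorm 0 1 f + schwartz_seminorm 1 0 f) * (1 / (1 + x\<^sup>2))"
proof (cases "x = 0")
  case True
  then show ?thesis
    using schwartz_seminorm_nonneg[OF assms] by (simp add: odd_quot_def)
next
  case False
  have "norm (f x - f (- x)) \<le> schwartz_seminorm 0 1 f * (2 * \<bar>x\<bar>)"
    using schwartz_lipschitz[OF assms, of x "- x"] by (simp add: abs_mult flip: mult_2)
  then have 1: "norm (odd_quot f x) \<le> schwartz_seminorm 0 1 f"
    using False by (simp add: odd_quot_def norm_divide norm_mult pos_divide_le_eq)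
  have "x\<^sup>2 = \<bar>x\<bar> * \<bar>x\<bar>"
    by (simp add: power2_eq_square)
  then have "norm (odd_quot f x) * x\<^sup>2 = norm (complex_of_real x * (f x - f (- x))) / 2"
    using False by (simp only: odd_quot_def norm_divide norm_mult norm_of_real) (simp del: abs_mult_self_eq)
  also have "\<dots> \<le> (norm (complex_of_real x * f x) + norm (complex_of_real (-x) * f (- x))) / 2"
    using norm_triangle_ineq[of "complex_of_real x * f x" "complex_of_real (-x) * f (- x)"]
    by (simp add: algebra_simps)
  also have "\<dots> \<le> schwartz_seminorm 1 0 f"
    using schwartz_seminorm_ge[OF assms, of x 1 0] schwartz_seminorm_ge[OF assms, of "-x" 1 0]
    by simp
  finally have "norm (odd_quot f x) * (1 + x\<^sup>2) \<le> schwartz_seminorm 0 1 f + schwartz_seminorm 1 0 f"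
    using 1 by (simp add: algebra_simps)
  moreover have "0 < 1 + x\<^sup>2" by (simp add: add_pos_nonneg)
  ultimately show ?thesis
    by (simp add: pos_le_divide_eq)
qed

lemma measurable_odd_quot: "schwartz f \<Longrightarrow> odd_quot f \<in> borel_measurable borel"
  unfolding odd_quot_def[abs_def] using schwartz_measurable[of f] by measurable

lemma integrable_odd_quot:
  assumes "schwartz f"
  shows "integrable lborel (odd_quot f)"
proof (rule Bochner_Integration.integrable_bound)
  let ?C = "schwartz_seminorm 0 1 f + schwartz_seminorm 1 0 f"
  show "integrable lborel (\<lambda>x. ?C * (1 / (1 + x\<^sup>2)))"
    by (intro integrable_mult_right integrable_cauchy_density)
  show "odd_quot f \<in> borel_measurable lborel"
    using measurable_odd_quot[OF assms] by simp
  show "AE x in lborel. norm (odd_quot f x) \<le> norm (?C * (1 / (1 + x\<^sup>2)))"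
    using order_trans[OF norm_odd_quot_le[OF assms] abs_ge_self] by (intro AE_I2) simp
qed

lemma set_integrable_div_outside_0:
  assumes "schwartz f" "0 < r"
  shows "set_integrable lborel {x. r < \<bar>x\<bar>} (\<lambda>x. f x / complex_of_real x)"
  unfolding set_integrable_def
proof (rule Bochner_Integration.integrable_bound)
  show "integrable lborel (\<lambda>x. inverse r *\<^sub>R f x)"
    by (intro integrable_scaleR_right schwartz_integrable assms)
  show "(\<lambda>x. indicat_real {x. r < \<bar>x\<bar>} x *\<^sub>R (f x / complex_of_real x)) \<in> borel_measurable lborel"
    using schwartz_measurable[OF assms(1)] by measurable
  show "AE x in lborel. norm (indicat_real {x. r < \<bar>x\<bar>} x *\<^sub>R (f x / complex_of_real x))
      \<le> norm (inverse r *\<^sub>R f x)"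
    using assms(2)
    by (intro AE_I2) (auto simp: indicator_def norm_divide field_simps intro!: mult_right_mono)
qed

text \<open>Averaging with the reflected integrand turns the truncated integrals of \<open>f x / x\<close> into those
  of an absolutely integrable function.\<close>

lemma pv_truncated_eq:
  assumes "schwartz f" "0 < r"
  shows "(LINT x:{x. r < \<bar>x\<bar>}|lborel. f x / complex_of_real x) =
         (LINT x:{x. r < \<bar>x\<bar>}|lborel. odd_quot f x)"
proof -
  let ?h = "\<lambda>x. indicat_real {x. r < \<bar>x\<bar>} x *\<^sub>R (f x / complex_of_real x)"
  have h: "integrable lborel ?h"
    using set_integrable_div_outside_0[OF assms] by (simp add: set_integrable_def)
  have h': "integrable lborel (\<lambda>x. ?h (0 + (-1) * x))"
    using h by (subst lborel_integrable_real_affine_iff) auto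
  have "integral\<^sup>L lborel ?h = (LINT x|lborel. ?h (0 + (-1) * x))"
    using lborel_integral_real_affine[of "-1" ?h 0] by simp
  then have "integral\<^sup>L lborel ?h = (1/2) *\<^sub>R (integral\<^sup>L lborel ?h + (LINT x|lborel. ?h (0 + (-1) * x)))"
    by (simp add: scaleR_2[symmetric] del: scaleR_2)
  also have "\<dots> = (LINT x|lborel. (1/2) *\<^sub>R (?h x + ?h (0 + (-1) * x)))"
    using h h' by simp
  also have "\<dots> = (LINT x|lborel. indicat_real {x. r < \<bar>x\<bar>} x *\<^sub>R odd_quot f x)"
    by (intro Bochner_Integration.integral_cong)
       (auto simp: indicator_def odd_quot_def scaleR_conv_of_real add_divide_distrib diff_divide_distrib mult.commute)
  finally show ?thesis
    by (simp add: set_lebesgue_integral_def)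
qed

lemma pv_truncated_tendsto:
  assumes "schwartz f"
  shows "((\<lambda>r. LINT x:{x. r < \<bar>x\<bar>}|lborel. f x / complex_of_real x) \<longlongrightarrow>
         (LINT x|lborel. odd_quot f x)) (at_right 0)"
proof -
  have [measurable]: "odd_quot f \<in> borel_measurable borel"
    by (rule measurable_odd_quot[OF assms])
  have "((\<lambda>r. LINT x:{x. r < \<bar>x\<bar>}|lborel. odd_quot f x) \<longlongrightarrow> (LINT x|lborel. odd_quot f x)) (at_right 0)"
    \<comment> \<open>The limit is tested along sequences, where dominated convergence
      applies.\<close>
    unfolding tendsto_at_iff_sequentially
  proof (intro allI impI)
    fix X :: "nat \<Rightarrow> real"
    assume "\<forall>i. X i \<in> {0<..} - {0}" and X: "X \<longlonglongrightarrow> 0"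
    then have pos: "0 < X i" for i by auto
    have "(\<lambda>i. LINT x|lborel. indicat_real {x. X i < \<bar>x\<bar>} x *\<^sub>R odd_quot f x)
        \<longlonglongrightarrow> (LINT x|lborel. odd_quot f x)"
    proof (rule integral_dominated_convergence)
      show "AE x in lborel. (\<lambda>i. indicat_real {x. X i < \<bar>x\<bar>} x *\<^sub>R odd_quot f x) \<longlonglongrightarrow> odd_quot f x"
      proof (rule AE_I2)
        fix x
        show "(\<lambda>i. indicat_real {x. X i < \<bar>x\<bar>} x *\<^sub>R odd_quot f x) \<longlonglongrightarrow> odd_quot f x"
        \<comment> \<open>For nonzero \<open>x\<close> the truncation is eventually inactive; at 0
          the numerator of \<open>odd_quot\<close> vanishes, so both sides are 0.\<close>
        proof (cases "x = 0")
          case False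
          then have "\<forall>\<^sub>F i in sequentially. X i < \<bar>x\<bar>"
            using order_tendstoD(2)[OF X] by simp
          then have "\<forall>\<^sub>F i in sequentially. indicat_real {x. X i < \<bar>x\<bar>} x *\<^sub>R odd_quot f x = odd_quot f x"
            by eventually_elim simp
          then show ?thesis by (rule tendsto_eventually)
        qed (simp add: odd_quot_def)
      qed
      show "integrable lborel (\<lambda>x. norm (odd_quot f x))"
        by (intro integrable_norm integrable_odd_quot assms)
      show "AE x in lborel. norm (indicat_real {x. X i < \<bar>x\<bar>} x *\<^sub>R odd_quot f x) \<le> norm (odd_quot f x)" for i
        by (intro AE_I2) (simp add: indicator_def)
    qed measurable
    then show "((\<lambda>r. LINT x:{x. r < \<bar>x\<bar>}|lborel. odd_quot f x) \<circ> X) \<longlonglongrightarrow> (LINT x|lborel. odd_quot f x)"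
      by (simp add: comp_def set_lebesgue_integral_def)
  qed
  moreover have "\<forall>\<^sub>F r in at_right (0::real). (LINT x:{x. r < \<bar>x\<bar>}|lborel. odd_quot f x) =
      (LINT x:{x. r < \<bar>x\<bar>}|lborel. f x / complex_of_real x)"
    using pv_truncated_eq[OF assms] by (simp add: eventually_at_filter)
  ultimately show ?thesis
    by (rule Lim_transform_eventually)
qed

lemma pv_inverse_eq: "schwartz f \<Longrightarrow> pv_inverse f = (LINT x|lborel. odd_quot f x)"
  unfolding pv_inverse_def by (intro tendsto_Lim pv_truncated_tendsto) auto

text \<open>Working with the truncated integrals avoids having to show that the sum is again
  Schwartz, which \<open>pv_inverse_eq\<close> would require.\<close>

lemma pv_inverse_plus:
  assumes "schwartz f" "schwartz h"
  shows "pv_inverse (\<lambda>x. f x + h x) = pv_inverse f + pv_inverse h"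
proof -
  have "((\<lambda>r. LINT x:{x. r < \<bar>x\<bar>}|lborel. (f x + h x) / complex_of_real x) \<longlongrightarrow>
      pv_inverse f + pv_inverse h) (at_right 0)"
  proof (rule Lim_transform_eventually)
    show "((\<lambda>r. (LINT x:{x. r < \<bar>x\<bar>}|lborel. f x / complex_of_real x) +
        (LINT x:{x. r < \<bar>x\<bar>}|lborel. h x / complex_of_real x)) \<longlongrightarrow> pv_inverse f + pv_inverse h) (at_right 0)"
      unfolding pv_inverse_eq[OF assms(1)] pv_inverse_eq[OF assms(2)]
      by (intro tendsto_add pv_truncated_tendsto assms)
    show "\<forall>\<^sub>F r in at_right (0::real). (LINT x:{x. r < \<bar>x\<bar>}|lborel. f x / complex_of_real x) +
        (LINT x:{x. r < \<bar>x\<bar>}|lborel. h x / complex_of_real x) =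
        (LINT x:{x. r < \<bar>x\<bar>}|lborel. (f x + h x) / complex_of_real x)"
      using set_integrable_div_outside_0[OF assms(1)] set_integrable_div_outside_0[OF assms(2)]
      by (simp add: eventually_at_filter add_divide_distrib set_integral_add)
  qed
  then show ?thesis
    unfolding pv_inverse_def[of "\<lambda>x. f x + h x"] by (intro tendsto_Lim) auto
qed

lemma pv_inverse_cmult:
  assumes "schwartz f"
  shows "pv_inverse (\<lambda>x. c * f x) = c * pv_inverse f"
proof -
  have "((\<lambda>r. LINT x:{x. r < \<bar>x\<bar>}|lborel. c * f x / complex_of_real x) \<longlongrightarrow> c * pv_inverse f) (at_right 0)"
    using tendsto_mult_left[OF pv_truncated_tendsto[OF assms], of c]
    by (simp add: pv_inverse_eq[OF assms] flip: set_integral_mult_right)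
  then show ?thesis
    unfolding pv_inverse_def[of "\<lambda>x. c * f x"] by (intro tendsto_Lim) auto
qed

lemma norm_pv_inverse_le:
  assumes "schwartz f"
  shows "norm (pv_inverse f) \<le> pi * (schwartz_seminorm 0 1 f + schwartz_seminorm 1 0 f)"
proof -
  let ?C = "schwartz_seminorm 0 1 f + schwartz_seminorm 1 0 f"
  have "norm (LINT x|lborel. odd_quot f x) \<le> (LINT x|lborel. ?C * (1 / (1 + x\<^sup>2)))"
    by (rule Bochner_Integration.integral_norm_bound_integral)
       (use assms in \<open>auto simp del: times_divide_eq_right One_nat_def intro!: integrable_odd_quot integrable_cauchy_density norm_odd_quot_le\<close>)
  also have "\<dots> = pi * ?C"
    by (subst integral_mult_right_zero) (simp add: integral_cauchy_density)
  finally show ?thesis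
    by (simp add: pv_inverse_eq[OF assms])
qed

text \<open>This is x pv(1/x) = 1: the odd part of \<open>x * f x\<close> divided by
  \<open>x\<close> is the even part of \<open>f\<close>, which has the same integral as
  \<open>f\<close>.\<close>

lemma pv_inverse_times_id:
  assumes "schwartz f" "schwartz (\<lambda>x. complex_of_real x * f x)"
  shows "pv_inverse (\<lambda>x. complex_of_real x * f x) = (LINT x|lborel. f x)"
proof -
  have f: "integrable lborel f"
    by (rule schwartz_integrable[OF assms(1)])
  have f': "integrable lborel (\<lambda>x. f (0 + (-1) * x))"
    using f by (subst lborel_integrable_real_affine_iff) auto
  have "pv_inverse (\<lambda>x. complex_of_real x * f x) =
      (LINT x|lborel. (1/2) *\<^sub>R (f x + f (0 + (-1) * x)))"
    unfolding pv_inverse_eq[OF assms(2)]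
  proof (rule integral_cong_AE)
    \<comment> \<open>Only almost everywhere: at 0 the left side is 0 while the right side is
      \<open>f 0\<close>.\<close>
    show "AE x in lborel. odd_quot (\<lambda>x. complex_of_real x * f x) x = (1/2) *\<^sub>R (f x + f (0 + (-1) * x))"
      using AE_lborel_singleton[of 0]
      by eventually_elim (simp add: odd_quot_def scaleR_conv_of_real field_simps)
  qed (use measurable_odd_quot[OF assms(2)] schwartz_measurable[OF assms(1)] in measurable)
  also have "\<dots> = (1/2) *\<^sub>R (integral\<^sup>L lborel f + (LINT x|lborel. f (0 + (-1) * x)))"
    using f f' by simp
  also have "(LINT x|lborel. f (0 + (-1) * x)) = integral\<^sup>L lborel f"
    using lborel_integral_real_affine[of "-1" f 0] by simp
  finally show ?thesis
    by (simp add: scaleR_2[symmetric] del: scaleR_2)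
qed

section \<open>Distributional derivatives and temperedness of \<open>Delta\<close>\<close>

lemma funpow_dist_deriv: "(dist_deriv ^^ n) T f = (-1) ^ n * T (nth_deriv n f)"
proof (induction n arbitrary: f)
  case (Suc n)
  have "nth_deriv n (\<lambda>x. vector_derivative f (at x)) = nth_deriv (Suc n) f"
    using nth_deriv_add[of n 1 f] by (simp add: nth_deriv_Suc)
  then show ?case
    by (simp add: Suc dist_deriv_def[of "(dist_deriv ^^ n) T"])
qed simp

text \<open>For \<open>s = 1\<close> and \<open>s = -1\<close> these are the boundary values 1/(x -
  i0) and 1/(x + i0).\<close>

definition pv_delta :: "complex \<Rightarrow> functional" where
  "pv_delta s h = pv_inverse h + \<i> * complex_of_real pi * s * dirac_delta h"

lemma pv_delta_plus:
  "schwartz f \<Longrightarrow> schwartz h \<Longrightarrow> pv_delta s (\<lambda>x. f x + h x) = pv_delta s f + pv_delta s h"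
  by (simp add: pv_delta_def pv_inverse_plus dirac_delta_def algebra_simps)

lemma pv_delta_cmult: "schwartz f \<Longrightarrow> pv_delta s (\<lambda>x. c * f x) = c * pv_delta s f"
  by (simp add: pv_delta_def pv_inverse_cmult dirac_delta_def algebra_simps)

text \<open>The delta term sees only the value at 0, where \<open>x * f x\<close> vanishes; hence x
  T = 1 whatever \<open>s\<close> is.\<close>

lemma pv_delta_times_id:
  assumes "schwartz f" "schwartz (\<lambda>x. complex_of_real x * f x)"
  shows "pv_delta s (\<lambda>x. complex_of_real x * f x) = (LINT x|lborel. f x)"
  using pv_inverse_times_id[OF assms] by (simp add: pv_delta_def dirac_delta_def)

lemma Delta_eq:
  assumes "g \<ge> 2"
  shows "Delta g m f = pv_delta (of_int (sgn m)) (nth_deriv (2 * g - 3) f) / fact (2 * g - 3)"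
proof -
  \<comment> \<open>Oddness makes the sign from moving the derivatives onto \<open>f\<close> cancel
    the minus sign in \<open>Delta\<close>.\<close>
  have "odd (2 * g - 3)" using assms by presburger
  then show ?thesis
    by (simp add: Delta_def funpow_dist_deriv pv_delta_def add_divide_distrib diff_divide_distrib)
qed

lemma norm_pv_delta_le:
  assumes "schwartz f" "norm s \<le> 1"
  shows "norm (pv_delta s f) \<le>
    pi * (schwartz_seminorm 0 1 f + schwartz_seminorm 1 0 f + schwartz_seminorm 0 0 f)"
proof -
  have "norm (\<i> * complex_of_real pi * s * dirac_delta f) = pi * (norm s * norm (f 0))"
    by (simp add: norm_mult dirac_delta_def)
  also have "\<dots> \<le> pi * (1 * schwartz_seminorm 0 0 f)"
    using assms schwartz_seminorm_ge[OF assms(1), of 0 0 0]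
    by (intro mult_left_mono mult_mono) auto
  finally show ?thesis
    unfolding pv_delta_def using norm_pv_inverse_le[OF assms(1)]
    by (intro norm_triangle_le) (simp add: algebra_simps)
qed

lemma tempered_distribution_Delta:
  assumes "g \<ge> 2"
  shows "tempered_distribution (Delta g m)"
  unfolding tempered_distribution_def
proof (intro conjI allI impI)
  fix f h assume fh: "schwartz f" "schwartz h"
  then show "Delta g m (\<lambda>x. f x + h x) = Delta g m f + Delta g m h"
    by (simp add: Delta_eq[OF assms] nth_deriv_plus pv_delta_plus schwartz_nth_deriv add_divide_distrib)
next
  fix c f assume "schwartz f"
  then show "Delta g m (\<lambda>x. c * f x) = c * Delta g m f"
    by (simp add: Delta_eq[OF assms] nth_deriv_cmult pv_delta_cmult schwartz_nth_deriv)
next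
  define n where "n = 2 * g - 3"
  show "\<exists>C N. \<forall>f. schwartz f \<longrightarrow> norm (Delta g m f) \<le> C * (\<Sum>k\<le>N. \<Sum>n\<le>N. schwartz_seminorm k n f)"
  proof (intro exI allI impI)
    fix f assume f: "schwartz f"
    \<comment> \<open>Differentiating \<open>n\<close> times shifts the derivative index by
      \<open>n\<close>, and \<open>norm_pv_delta_le\<close> needs one further order, so indices up
      to \<open>n + 1\<close> suffice. Each of its three seminorms is at most \<open>S\<close>,
      whence the constant \<open>3 * pi\<close>.\<close>
    define S where "S = (\<Sum>k\<le>n+1. \<Sum>j\<le>n+1. schwartz_seminorm k j f)"
    have le: "schwartz_seminorm k j f \<le> S" if "k \<le> n + 1" "j \<le> n + 1" for k j
    proof -
      have "schwartz_seminorm k j f \<le> (\<Sum>j\<le>n+1. schwartz_seminorm k j f)"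
        using that by (intro member_le_sum) (auto simp: schwartz_seminorm_nonneg[OF f])
      also have "\<dots> \<le> S"
        unfolding S_def using that
        by (intro member_le_sum[of k _ "\<lambda>k. \<Sum>j\<le>n+1. schwartz_seminorm k j f"])
           (auto intro!: sum_nonneg schwartz_seminorm_nonneg[OF f] simp del: sum.atMost_Suc)
      finally show ?thesis .
    qed
    have "norm (Delta g m f) \<le> norm (pv_delta (of_int (sgn m)) (nth_deriv n f))"
      by (simp add: Delta_eq[OF assms] norm_divide n_def divide_le_eq mult_ge1_I mult_right_le_one_le
            mult_le_cancel_left1)
    also have "\<dots> \<le> pi * (schwartz_seminorm 0 (1 + n) f + schwartz_seminorm 1 (0 + n) f + schwartz_seminorm 0 (0 + n) f)"
      using norm_pv_delta_le[OF schwartz_nth_deriv[OF f], of "of_int (sgn m)" n]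
      by (simp add: schwartz_seminorm_nth_deriv sgn_if)
    also have "\<dots> \<le> pi * (S + S + S)"
      by (intro mult_left_mono[OF add_mono[OF add_mono]] le) auto
    also have "\<dots> = 3 * pi * S"
      by simp
    finally show "norm (Delta g m f) \<le> (3 * pi) * (\<Sum>k\<le>n+1. \<Sum>j\<le>n+1. schwartz_seminorm k j f)"
      unfolding S_def .
  qed
qed


section \<open>Hermite polynomials and derivatives of Gaussians\<close>

text \<open>Rescaled Hermite polynomials, with exponential generating function
  \<open>exp (v * t + a * t\<^sup>2)\<close>. The free parameter \<open>a\<close> serves both the
  Hermite polynomials (\<open>a = -1\<close>) and the Gaussian
  (\<open>a = - \<epsilon>\<close>).\<close>

fun gauss_poly :: "complex \<Rightarrow> nat \<Rightarrow> complex \<Rightarrow> complex" where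
  "gauss_poly a 0 v = 1"
| "gauss_poly a (Suc 0) v = v"
| "gauss_poly a (Suc (Suc n)) v = v * gauss_poly a (Suc n) v + 2 * a * of_nat (Suc n) * gauss_poly a n v"

text \<open>The factor \<open>of_nat n\<close> kills the truncated index \<open>n - 1\<close> at
  \<open>n = 0\<close>, so one recursion covers all \<open>n\<close>.\<close>

lemma gauss_poly_Suc:
  "gauss_poly a (Suc n) v = v * gauss_poly a n v + 2 * a * of_nat n * gauss_poly a (n - 1) v"
  by (cases n) auto

text \<open>The Appell property. Differentiating the recursion leaves one copy of
  \<open>gauss_poly a (Suc n)\<close> from the factor \<open>v\<close>, and the remaining terms
  regroup by the recursion into \<open>Suc n\<close> further copies.\<close>

lemma has_field_derivative_gauss_poly:
  "(gauss_poly a n has_field_derivative of_nat n * gauss_poly a (n - 1) v) (at v)"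
proof (induction a n v rule: gauss_poly.induct)
  case (3 a n v)
  have "((\<lambda>v. v * gauss_poly a (Suc n) v + 2 * a * of_nat (Suc n) * gauss_poly a n v)
      has_field_derivative
      (1 * gauss_poly a (Suc n) v + of_nat (Suc n) * gauss_poly a (Suc n - 1) v * v
        + 2 * a * of_nat (Suc n) * (of_nat n * gauss_poly a (n - 1) v))) (at v)"
    by (intro DERIV_add DERIV_mult DERIV_ident DERIV_cmult 3)
  moreover have "1 * gauss_poly a (Suc n) v + of_nat (Suc n) * gauss_poly a (Suc n - 1) v * v
        + 2 * a * of_nat (Suc n) * (of_nat n * gauss_poly a (n - 1) v)
      = of_nat (Suc (Suc n)) * gauss_poly a (Suc n) v"
    by (simp add: gauss_poly_Suc[of a n] algebra_simps)
  moreover have "gauss_poly a (Suc (Suc n)) =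
      (\<lambda>v. v * gauss_poly a (Suc n) v + 2 * a * of_nat (Suc n) * gauss_poly a n v)"
    by (rule ext) simp
  ultimately show ?case
    by (simp only: diff_Suc_1)
next
  case (1 a v)
  have "gauss_poly a 0 = (\<lambda>v. 1)" by (rule ext) simp
  then show ?case by simp
next
  case (2 a v)
  have "gauss_poly a (Suc 0) = (\<lambda>v. v)" by (rule ext) simp
  then show ?case by simp
qed

text \<open>A Rodrigues formula: with \<open>v = b + 2 * a * w\<close> the exponential contributes a
  factor \<open>v\<close> and the chain rule a factor \<open>2 * a\<close>, which is exactly the
  recursion \<open>gauss_poly_Suc\<close>.\<close>

lemma has_field_derivative_gauss_poly_exp:
  "((\<lambda>w. gauss_poly a n (b + 2 * a * w) * exp (a * w\<^sup>2 + b * w)) has_field_derivative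
    gauss_poly a (Suc n) (b + 2 * a * w) * exp (a * w\<^sup>2 + b * w)) (at w)"
proof -
  have "((\<lambda>w. gauss_poly a n (b + 2 * a * w)) has_field_derivative
      of_nat n * gauss_poly a (n - 1) (b + 2 * a * w) * (2 * a)) (at w)"
    by (rule DERIV_chain2[OF has_field_derivative_gauss_poly]) (auto intro!: derivative_eq_intros)
  moreover have "((\<lambda>w. exp (a * w\<^sup>2 + b * w)) has_field_derivative
      exp (a * w\<^sup>2 + b * w) * (b + 2 * a * w)) (at w)"
    by (auto intro!: derivative_eq_intros)
  ultimately show ?thesis
    by (rule DERIV_mult[THEN DERIV_cong]) (simp add: gauss_poly_Suc algebra_simps)
qed

lemma hermite_eq_gauss_poly: "hermite n x = gauss_poly (-1) n (2 * x)"
proof -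
  have "(deriv ^^ n) (\<lambda>t. exp (2 * x * t - t\<^sup>2)) =
      (\<lambda>t. gauss_poly (-1) n (2 * x + 2 * (-1) * t) * exp ((-1) * t\<^sup>2 + 2 * x * t))"
  proof (induction n)
    case (Suc n)
    show ?case
      unfolding funpow.simps o_apply Suc
      by (intro ext DERIV_imp_deriv has_field_derivative_gauss_poly_exp)
  qed simp
  then show ?thesis
    by (simp add: hermite_def)
qed

text \<open>Homogeneity with weight 1 for \<open>v\<close> and 2 for \<open>a\<close>. It gives
  parity for \<open>c = -1\<close> and the change of parameter for
  \<open>c = sqrt \<epsilon>\<close>.\<close>

lemma gauss_poly_scale: "gauss_poly (c\<^sup>2 * a) n (c * v) = c ^ n * gauss_poly a n v"
  by (induction a n v rule: gauss_poly.induct) (simp_all add: algebra_simps power2_eq_square)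

text \<open>\<open>B\<close> is the series of \<open>exp (a * X\<^sup>2)\<close>. The product
  \<open>F\<close> solves F' = (v + 2 a X) F, and comparing coefficients in this equation reproduces
  the recursion of \<open>gauss_poly\<close>.\<close>

lemma fps_nth_gauss_poly:
  fixes a v :: complex
  defines "B \<equiv> Abs_fps (\<lambda>n. if even n then a ^ (n div 2) / fact (n div 2) else 0)"
  shows "gauss_poly a n v = fact n * fps_nth (B * fps_exp v) n"
proof -
  define F where "F = B * fps_exp v"
  have "fps_deriv B = fps_const (2 * a) * fps_X * B"
  proof (rule fps_ext)
    fix n
    show "fps_nth (fps_deriv B) n = fps_nth (fps_const (2 * a) * fps_X * B) n"
    proof (cases n)
      case (Suc k)
      show ?thesis
      proof (cases "even k")
        case True
        then obtain j where "k = 2 * j" by (elim evenE)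
        moreover have "1 + complex_of_nat j \<noteq> 0"
          by (metis of_nat_Suc of_nat_neq_0)
        ultimately show ?thesis
          using Suc by (simp add: B_def mult.assoc divide_simps)
      qed (use Suc in \<open>simp add: B_def mult.assoc\<close>)
    qed (simp add: B_def mult.assoc)
  qed
  then have deriv: "fps_deriv F = fps_const v * F + fps_const (2 * a) * (fps_X * F)"
    by (simp add: F_def algebra_simps)
  have rec: "of_nat (Suc n) * fps_nth F (Suc n) = v * fps_nth F n + 2 * a * (if n = 0 then 0 else fps_nth F (n - 1))" for n
    using arg_cong[OF deriv, of "\<lambda>f. fps_nth f n"] by simp
  have "gauss_poly a n v = fact n * fps_nth F n"
  proof (induction n rule: less_induct)
    case (less n)
    show ?case
    proof (cases n)
      case 0
      then show ?thesis by (simp add: F_def B_def)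
    next
      case (Suc k)
      have "fact n * fps_nth F n = fact k * (of_nat (Suc k) * fps_nth F (Suc k))"
        using Suc by (simp add: algebra_simps)
      also have "\<dots> = v * (fact k * fps_nth F k) +
          2 * a * (if k = 0 then 0 else of_nat k * (fact (k - 1) * fps_nth F (k - 1)))"
        unfolding rec by (cases k) (simp_all add: algebra_simps)
      also have "\<dots> = v * gauss_poly a k v + 2 * a * of_nat k * gauss_poly a (k - 1) v"
        using less[of k] less[of "k - 1"] Suc by (cases "k = 0") auto
      finally show ?thesis
        using Suc by (simp add: gauss_poly_Suc)
    qed
  qed
  then show ?thesis by (simp add: F_def)
qed

lemma sum_even_reindex:
  fixes f :: "nat \<Rightarrow> complex"
  shows "(\<Sum>i=0..2*N+1. if even i then f i else 0) = (\<Sum>m=0..N. f (2 * m))"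
  by (induction N) (auto simp: algebra_simps)

lemma gauss_poly_odd_explicit:
  "gauss_poly a (2 * N + 1) v = fact (2 * N + 1) *
    (\<Sum>m=0..N. a ^ m / (fact m * fact (2 * N + 1 - 2 * m)) * v ^ (2 * N + 1 - 2 * m))"
proof -
  have "gauss_poly a (2 * N + 1) v = fact (2 * N + 1) * (\<Sum>i=0..2*N+1.
      if even i then a ^ (i div 2) / fact (i div 2) * (v ^ (2 * N + 1 - i) / fact (2 * N + 1 - i)) else 0)"
    unfolding fps_nth_gauss_poly fps_mult_nth
    by (intro arg_cong2[of _ _ _ _ "(*)"] sum.cong refl) auto
  also note sum_even_reindex
  finally show ?thesis
    by simp
qed

text \<open>The new factor \<open>2 * l + 1\<close> is the one that appears when an even moment is
  raised by two orders.\<close>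

lemma double_fact_odd_Suc:
  "double_fact (2 * int (Suc l) - 1) = (2 * int l + 1) * double_fact (2 * int l - 1)"
proof -
  have "{j \<in> {1..2 * int (Suc l) - 1}. even (2 * int (Suc l) - 1 - j)} =
      insert (2 * int l + 1) {j \<in> {1..2 * int l - 1}. even (2 * int l - 1 - j)}"
    by (auto; presburger)
  moreover have "finite {j \<in> {1..2 * int l - 1}. even (2 * int l - 1 - j)}"
    by (rule finite_subset[of _ "{1..2 * int l - 1}"]) auto
  ultimately show ?thesis
    unfolding double_fact_def by (simp only:) (subst prod.insert, auto)
qed

lemma double_fact_minus_1: "double_fact (-1) = 1"
  by (simp add: double_fact_def)

section \<open>The modulated Gaussian and its polynomial multiples\<close>

definition gexp :: "real \<Rightarrow> real \<Rightarrow> real \<Rightarrow> complex" where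
  "gexp \<epsilon> t x = exp (- complex_of_real \<epsilon> * (complex_of_real x)\<^sup>2 + \<i> * complex_of_real t * complex_of_real x)"

text \<open>The logarithmic derivative of \<open>gexp\<close>, kept as a polynomial in
  \<open>x\<close> so that the pairings below become linear functionals on polynomials.\<close>

definition gvar :: "real \<Rightarrow> real \<Rightarrow> complex poly" where
  "gvar \<epsilon> t = [:\<i> * complex_of_real t, 2 * (- complex_of_real \<epsilon>):]"

lemma poly_gvar: "poly (gvar \<epsilon> t) x = \<i> * complex_of_real t + 2 * (- complex_of_real \<epsilon>) * x"
  by (simp add: gvar_def)

lemma norm_gexp: "norm (gexp \<epsilon> t x) = exp (- \<epsilon> * x\<^sup>2)"
  by (simp add: gexp_def flip: of_real_power)

lemma gexp_0 [simp]: "gexp \<epsilon> t 0 = 1"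
  by (simp add: gexp_def)

lemma nth_deriv_gexp:
  "nth_deriv n (gexp \<epsilon> t) =
    (\<lambda>x. gauss_poly (- complex_of_real \<epsilon>) n (poly (gvar \<epsilon> t) (complex_of_real x)) * gexp \<epsilon> t x)"
proof (induction n)
  case (Suc n)
  show ?case
    unfolding nth_deriv_Suc Suc
    unfolding poly_gvar gexp_def
    by (intro ext vector_derivative_at has_vector_derivative_real_field has_field_derivative_gauss_poly_exp)
qed simp

lemma has_vector_derivative_poly_gexp:
  "((\<lambda>x. poly p (complex_of_real x) * gexp \<epsilon> t x) has_vector_derivative
    poly (pderiv p + gvar \<epsilon> t * p) (complex_of_real x) * gexp \<epsilon> t x) (at x)"
proof -
  have "((\<lambda>w. poly p w * exp (- complex_of_real \<epsilon> * w\<^sup>2 + \<i> * complex_of_real t * w)) has_field_derivative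
      poly (pderiv p + gvar \<epsilon> t * p) w * exp (- complex_of_real \<epsilon> * w\<^sup>2 + \<i> * complex_of_real t * w)) (at w)" for w
    by (auto intro!: derivative_eq_intros poly_DERIV simp: poly_gvar algebra_simps)
  then show ?thesis
    unfolding gexp_def by (rule has_vector_derivative_real_field)
qed

text \<open>Polynomial multiples of the Gaussian are closed under differentiation, so one
  boundedness lemma settles every derivative in \<open>schwartz\<close>.\<close>

lemma nth_deriv_poly_gexp:
  "nth_deriv n (\<lambda>x. poly p (complex_of_real x) * gexp \<epsilon> t x) =
    (\<lambda>x. poly (((\<lambda>p. pderiv p + gvar \<epsilon> t * p) ^^ n) p) (complex_of_real x) * gexp \<epsilon> t x)"
proof (induction n)
  case (Suc n)
  show ?case
    unfolding nth_deriv_Suc Suc funpow.simps o_apply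
    by (intro ext vector_derivative_at has_vector_derivative_poly_gexp)
qed simp

text \<open>A single term of the exponential series bounds the even power
  \<open>x\<^sup>2 ^ k\<close>; a general power is compared with it through
  \<open>\<bar>x\<bar> ^ k \<le> 1 + x\<^sup>2 ^ k\<close>.\<close>

lemma power_times_gaussian_le:
  fixes x \<epsilon> :: real
  assumes "\<epsilon> > 0"
  shows "\<bar>x\<bar> ^ k * exp (- \<epsilon> * x\<^sup>2) \<le> 1 + fact k / \<epsilon> ^ k"
proof -
  have "(\<epsilon> * x\<^sup>2) ^ k / fact k \<le> exp (\<epsilon> * x\<^sup>2)"
    using sum_le_suminf[OF summable_exp_generic[of "\<epsilon> * x\<^sup>2"], of "{k}"] assms
    by (simp add: exp_def divide_inverse mult.commute)
  then have 1: "x\<^sup>2 ^ k * exp (- \<epsilon> * x\<^sup>2) \<le> fact k / \<epsilon> ^ k"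
    using assms by (simp add: exp_minus field_simps)
  have "\<bar>x\<bar> ^ k \<le> 1 + x\<^sup>2 ^ k"
  proof (cases "\<bar>x\<bar> \<le> 1")
    case True
    then show ?thesis by (simp add: power_le_one add_increasing2)
  next
    case False
    then have "\<bar>x\<bar> ^ k \<le> \<bar>x\<bar> ^ (2 * k)" by (intro power_increasing) auto
    then show ?thesis by (simp add: power_mult)
  qed
  then have "\<bar>x\<bar> ^ k * exp (- \<epsilon> * x\<^sup>2) \<le> (1 + x\<^sup>2 ^ k) * exp (- \<epsilon> * x\<^sup>2)"
    by (intro mult_right_mono) auto
  also have "\<dots> \<le> 1 + fact k / \<epsilon> ^ k"
    using 1 assms by (simp add: algebra_simps add_mono)
  finally show ?thesis .
qed

lemma bounded_poly_gexp:
  assumes "\<epsilon> > 0"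
  shows "bounded (range (\<lambda>x. complex_of_real (x ^ k) * (poly p (complex_of_real x) * gexp \<epsilon> t x)))"
\<comment> \<open>\<open>k\<close> must vary: the factor \<open>x\<close> in front of the tail
  polynomial is absorbed into \<open>x ^ k\<close>.\<close>
proof (induction p arbitrary: k)
  case 0
  then show ?case by (auto simp: bounded_iff)
next
  case (pCons a p)
  have "bounded (range (\<lambda>x. complex_of_real (x ^ k) * gexp \<epsilon> t x))"
    unfolding bounded_iff using power_times_gaussian_le[OF assms]
    by (intro exI[of _ "1 + fact k / \<epsilon> ^ k"]) (auto simp: norm_mult norm_power norm_gexp power_abs)
  then have "bounded ((\<lambda>x. a * x) ` range (\<lambda>x. complex_of_real (x ^ k) * gexp \<epsilon> t x))"
    by (rule bounded_linear_image) (rule bounded_linear_mult_right)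
  then have "bounded (range (\<lambda>x. a * (complex_of_real (x ^ k) * gexp \<epsilon> t x)))"
    by (simp add: image_image)
  from bounded_plus_comp[OF this pCons(2)[of "Suc k"]] show ?case
    by (simp add: algebra_simps)
qed

lemma schwartz_poly_gexp:
  assumes "\<epsilon> > 0"
  shows "schwartz (\<lambda>x. poly p (complex_of_real x) * gexp \<epsilon> t x)"
  unfolding schwartz_def nth_deriv_poly_gexp
  using bounded_poly_gexp[OF assms] has_vector_derivative_poly_gexp
  by (blast intro: differentiableI_vector)


section \<open>Gaussian integrals\<close>

text \<open>The characteristic function of the standard normal law at \<open>t / c\<close>; the
  scaling \<open>c = sqrt (2 * \<epsilon>)\<close> turns its density into a multiple of
  \<open>exp (- \<epsilon> * x\<^sup>2)\<close>.\<close>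

lemma integral_gexp:
  assumes "\<epsilon> > 0"
  shows "(LINT x|lborel. gexp \<epsilon> t x) = complex_of_real (sqrt (pi / \<epsilon>) * exp (- (t\<^sup>2 / (4 * \<epsilon>))))"
proof -
  define c where "c = sqrt (2 * \<epsilon>)"
  have c: "c > 0" "c\<^sup>2 = 2 * \<epsilon>" using assms by (auto simp: c_def)
  have "complex_of_real (exp (- (t / c)\<^sup>2 / 2)) = char std_normal_distribution (t / c)"
    by (simp add: char_std_normal_distribution)
  also have "\<dots> = (LINT x|lborel. std_normal_density x *\<^sub>R iexp (t / c * x))"
    unfolding char_def by (subst integral_density) (auto simp: normal_density_nonneg)
  also have "\<dots> = c *\<^sub>R (LINT x|lborel. std_normal_density (0 + c * x) *\<^sub>R iexp (t / c * (0 + c * x)))"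
    using lborel_integral_real_affine[of c "\<lambda>x. std_normal_density x *\<^sub>R iexp (t / c * x)" 0] c by simp
  also have "(\<lambda>x. std_normal_density (0 + c * x) *\<^sub>R iexp (t / c * (0 + c * x))) =
      (\<lambda>x. complex_of_real (1 / sqrt (2 * pi)) * gexp \<epsilon> t x)"
  proof
    fix x
    have "(c * x)\<^sup>2 / 2 = \<epsilon> * x\<^sup>2"
      using c by (simp add: power_mult_distrib)
    then have "complex_of_real (std_normal_density (c * x)) =
        complex_of_real (1 / sqrt (2 * pi)) * exp (- complex_of_real \<epsilon> * (complex_of_real x)\<^sup>2)"
      by (simp add: std_normal_density_def exp_of_real[symmetric])
    then show "std_normal_density (0 + c * x) *\<^sub>R iexp (t / c * (0 + c * x)) =
        complex_of_real (1 / sqrt (2 * pi)) * gexp \<epsilon> t x"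
      using c by (simp add: gexp_def exp_add scaleR_conv_of_real mult.assoc exp_diff exp_minus divide_simps)
  qed
  also have "c *\<^sub>R (LINT x|lborel. complex_of_real (1 / sqrt (2 * pi)) * gexp \<epsilon> t x) =
      complex_of_real (c / sqrt (2 * pi)) * (LINT x|lborel. gexp \<epsilon> t x)"
    by (simp add: scaleR_conv_of_real)
  finally have "complex_of_real (sqrt (2 * pi) / c) * complex_of_real (exp (- (t / c)\<^sup>2 / 2)) =
      complex_of_real (sqrt (2 * pi) / c) * (complex_of_real (c / sqrt (2 * pi)) * (LINT x|lborel. gexp \<epsilon> t x))"
    by simp
  also have "\<dots> = (LINT x|lborel. gexp \<epsilon> t x)"
    using c by simp
  also have "sqrt (2 * pi) / c = sqrt (pi / \<epsilon>)"
    by (simp add: c_def real_sqrt_divide[symmetric])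
  also have "- (t / c)\<^sup>2 / 2 = - (t\<^sup>2 / (4 * \<epsilon>))"
    using c by (simp add: power_divide)
  finally show ?thesis
    by simp
qed

lemma integrable_gexp: "\<epsilon> > 0 \<Longrightarrow> integrable lborel (gexp \<epsilon> t)"
  using schwartz_integrable[OF schwartz_poly_gexp[of \<epsilon> 1 t]] by simp

lemma integrable_gaussian: "\<epsilon> > 0 \<Longrightarrow> integrable lborel (\<lambda>x::real. exp (- \<epsilon> * x\<^sup>2))"
  using integrable_norm[OF integrable_gexp[of \<epsilon> 0]] by (simp add: norm_gexp)

lemma gexp_polar:
  "gexp \<epsilon> t x = complex_of_real (exp (- \<epsilon> * x\<^sup>2)) * exp (\<i> * complex_of_real (t * x))"
  unfolding gexp_def exp_add by (simp add: exp_of_real[symmetric] mult.assoc)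

lemma Re_gexp: "Re (gexp \<epsilon> t x) = exp (- \<epsilon> * x\<^sup>2) * cos (t * x)"
  by (simp add: gexp_polar Re_exp)

lemma integral_gaussian_cos:
  assumes "\<epsilon> > 0"
  shows "(LINT x|lborel. exp (- \<epsilon> * x\<^sup>2) * cos (t * x)) = sqrt (pi / \<epsilon>) * exp (- (t\<^sup>2 / (4 * \<epsilon>)))"
proof -
  have "(LINT x|lborel. Re (gexp \<epsilon> t x)) = Re (LINT x|lborel. gexp \<epsilon> t x)"
    by (rule integral_Re[OF integrable_gexp[OF assms]])
  then show ?thesis
    by (simp add: Re_gexp integral_gexp[OF assms] del: of_real_mult)
qed

section \<open>A damped sine integral and the error function\<close>

lemma abs_sin_diff_le: "\<bar>sin a - sin b\<bar> \<le> \<bar>a - b\<bar>" for a b :: real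
proof -
  have "\<bar>sin a - sin b\<bar> = 2 * \<bar>sin ((a - b) / 2)\<bar> * \<bar>cos ((a + b) / 2)\<bar>"
    by (simp add: sin_diff_sin abs_mult)
  also have "\<dots> \<le> 2 * \<bar>(a - b) / 2\<bar> * 1"
    by (intro mult_mono mult_left_mono abs_sin_x_le_abs_x) auto
  finally show ?thesis by simp
qed

definition gauss_sinc :: "real \<Rightarrow> real \<Rightarrow> real" where
  "gauss_sinc \<epsilon> t = (LINT x|lborel. exp (- \<epsilon> * x\<^sup>2) * sin (t * x) / x)"

lemma integrable_gauss_sinc:
  assumes "\<epsilon> > 0"
  shows "integrable lborel (\<lambda>x::real. exp (- \<epsilon> * x\<^sup>2) * sin (t * x) / x)"
proof (rule Bochner_Integration.integrable_bound)
  show "integrable lborel (\<lambda>x. \<bar>t\<bar> * exp (- \<epsilon> * x\<^sup>2))"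
    by (intro integrable_mult_right integrable_gaussian assms)
  show "AE x in lborel. norm (exp (- \<epsilon> * x\<^sup>2) * sin (t * x) / x) \<le> norm (\<bar>t\<bar> * exp (- \<epsilon> * x\<^sup>2))"
  proof (rule AE_I2)
    fix x
    have "\<bar>sin (t * x)\<bar> / \<bar>x\<bar> \<le> \<bar>t\<bar>"
      using abs_sin_x_le_abs_x[of "t * x"] by (cases "x = 0") (auto simp: pos_divide_le_eq abs_mult)
    then show "norm (exp (- \<epsilon> * x\<^sup>2) * sin (t * x) / x) \<le> norm (\<bar>t\<bar> * exp (- \<epsilon> * x\<^sup>2))"
      using mult_left_mono[of "\<bar>sin (t * x)\<bar> / \<bar>x\<bar>" "\<bar>t\<bar>" "exp (- \<epsilon> * x\<^sup>2)"]
      by (simp add: abs_mult mult.commute)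
  qed
qed measurable

text \<open>Differentiation under the integral. Since the sine is 1-Lipschitz, the difference
  quotients are dominated by the Gaussian, and the limit is the cosine transform already
  computed.\<close>

lemma DERIV_gauss_sinc:
  assumes "\<epsilon> > 0"
  shows "(gauss_sinc \<epsilon> has_real_derivative sqrt (pi / \<epsilon>) * exp (- (t\<^sup>2 / (4 * \<epsilon>)))) (at t)"
  unfolding DERIV_def tendsto_at_iff_sequentially
proof (intro allI impI)
  fix X :: "nat \<Rightarrow> real"
  assume "\<forall>i. X i \<in> UNIV - {0}" and X: "X \<longlonglongrightarrow> 0"
  then have nz: "X i \<noteq> 0" for i by auto
  let ?q = "\<lambda>i x. exp (- \<epsilon> * x\<^sup>2) * ((sin ((t + X i) * x) - sin (t * x)) / (X i * x))"
  have "(\<lambda>i. LINT x|lborel. ?q i x) \<longlonglongrightarrow> (LINT x|lborel. exp (- \<epsilon> * x\<^sup>2) * cos (t * x))"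
  proof (rule integral_dominated_convergence)
    show "integrable lborel (\<lambda>x. exp (- \<epsilon> * x\<^sup>2))"
      by (rule integrable_gaussian[OF assms])
    show "AE x in lborel. norm (?q i x) \<le> exp (- \<epsilon> * x\<^sup>2)" for i
    proof (rule AE_I2)
      fix x
      have "\<bar>sin ((t + X i) * x) - sin (t * x)\<bar> / \<bar>X i * x\<bar> \<le> 1"
        using abs_sin_diff_le[of "(t + X i) * x" "t * x"]
        by (cases "x = 0") (auto simp: nz divide_le_eq algebra_simps)
      then show "norm (?q i x) \<le> exp (- \<epsilon> * x\<^sup>2)"
        unfolding real_norm_def abs_mult abs_divide by (simp only: abs_exp_cancel mult_left_le exp_ge_zero)
    qed
    show "AE x in lborel. (\<lambda>i. ?q i x) \<longlonglongrightarrow> exp (- \<epsilon> * x\<^sup>2) * cos (t * x)"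
      \<comment> \<open>The point 0 is excluded: there the quotients are 0 by convention, but the
        limit function is 1.\<close>
      using AE_lborel_singleton[of 0]
    proof eventually_elim
      case (elim x)
      have "((\<lambda>u. sin (u * x)) has_real_derivative cos (t * x) * x) (at t)"
        by (auto intro!: derivative_eq_intros)
      then have "(\<lambda>i. (sin ((t + X i) * x) - sin (t * x)) / X i) \<longlonglongrightarrow> cos (t * x) * x"
        unfolding DERIV_def tendsto_at_iff_sequentially using X nz by (auto simp: comp_def)
      then have "(\<lambda>i. (sin ((t + X i) * x) - sin (t * x)) / X i / x) \<longlonglongrightarrow> cos (t * x) * x / x"
        using elim by (intro tendsto_divide tendsto_const) auto
      then show ?case
        using elim by (intro tendsto_mult tendsto_const) (simp add: divide_divide_eq_left)
    qed
  qed measurable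
  moreover have "(LINT x|lborel. ?q i x) = (gauss_sinc \<epsilon> (t + X i) - gauss_sinc \<epsilon> t) / X i" for i
  proof -
    have "gauss_sinc \<epsilon> (t + X i) - gauss_sinc \<epsilon> t = (LINT x|lborel.
        exp (- \<epsilon> * x\<^sup>2) * sin ((t + X i) * x) / x - exp (- \<epsilon> * x\<^sup>2) * sin (t * x) / x)"
      unfolding gauss_sinc_def
      by (intro Bochner_Integration.integral_diff[symmetric] integrable_gauss_sinc assms)
    then have "(gauss_sinc \<epsilon> (t + X i) - gauss_sinc \<epsilon> t) / X i = (LINT x|lborel.
        (exp (- \<epsilon> * x\<^sup>2) * sin ((t + X i) * x) / x - exp (- \<epsilon> * x\<^sup>2) * sin (t * x) / x) / X i)"
      by simp
    also have "\<dots> = (LINT x|lborel. ?q i x)"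
      by (intro Bochner_Integration.integral_cong refl)
         (simp add: diff_divide_distrib right_diff_distrib mult.commute)
    finally show ?thesis ..
  qed
  ultimately show "((\<lambda>h. (gauss_sinc \<epsilon> (t + h) - gauss_sinc \<epsilon> t) / h) \<circ> X)
      \<longlonglongrightarrow> sqrt (pi / \<epsilon>) * exp (- (t\<^sup>2 / (4 * \<epsilon>)))"
    by (simp only: comp_def integral_gaussian_cos[OF assms])
qed

lemma erfc_0: "erfc 0 = 1"
  using gaussian_moment_0
  by (simp add: erfc_def set_lebesgue_integral_def has_bochner_integral_iff)

lemma set_integrable_gaussian:
  "A \<in> sets borel \<Longrightarrow> set_integrable lborel A (\<lambda>t::real. exp (- t\<^sup>2))"
  using integrable_mult_indicator[of A lborel, OF _ integrable_gaussian[of 1]]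
  by (simp add: set_integrable_def)

lemma erfc_diff:
  assumes "a \<le> y"
  shows "erfc y = erfc a - 2 / sqrt pi * integral {a..y} (\<lambda>t. exp (- t\<^sup>2))"
proof -
  have "{a..} = {a..<y} \<union> {y..}" using assms by auto
  then have "(LINT t:{a..}|lborel. exp (- t\<^sup>2)) =
      (LINT t:{a..<y}|lborel. exp (- t\<^sup>2)) + (LINT t:{y..}|lborel. exp (- t\<^sup>2))"
    by (simp only:) (intro set_integral_Un set_integrable_gaussian; auto)
  also have "(LINT t:{a..<y}|lborel. exp (- t\<^sup>2)) = (LINT t:{a..y}|lborel. exp (- t\<^sup>2))"
    unfolding set_lebesgue_integral_def
    by (intro integral_cong_AE) (use AE_lborel_singleton[of y] in \<open>auto split: split_indicator elim: eventually_mono\<close>)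
  also have "\<dots> = integral {a..y} (\<lambda>t. exp (- t\<^sup>2))"
    by (intro set_borel_integral_eq_integral set_integrable_gaussian) auto
  finally show ?thesis
    by (simp add: erfc_def algebra_simps)
qed

lemma DERIV_erfc: "(erfc has_real_derivative - (2 / sqrt pi * exp (- x\<^sup>2))) (at x)"
proof -
  have "((\<lambda>y. integral {x - 1..y} (\<lambda>t. exp (- t\<^sup>2))) has_real_derivative exp (- x\<^sup>2))
      (at x within {x - 1..x + 1})"
    by (rule integral_has_real_derivative) (auto intro!: continuous_intros)
  then have "((\<lambda>y. erfc (x - 1) - 2 / sqrt pi * integral {x - 1..y} (\<lambda>t. exp (- t\<^sup>2)))
      has_real_derivative 0 - 2 / sqrt pi * exp (- x\<^sup>2)) (at x within {x - 1..x + 1})"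
    by (intro DERIV_diff DERIV_const DERIV_cmult)
  then have "(erfc has_real_derivative - (2 / sqrt pi * exp (- x\<^sup>2))) (at x within {x - 1..x + 1})"
    unfolding diff_0
  proof (rule has_field_derivative_transform_within[where d = 1])
    fix y assume "y \<in> {x - 1..x + 1}"
    then show "erfc (x - 1) - 2 / sqrt pi * integral {x - 1..y} (\<lambda>t. exp (- t\<^sup>2)) = erfc y"
      by (intro erfc_diff[symmetric]) simp
  qed auto
  then show ?thesis
    by (simp add: at_within_Icc_at)
qed

text \<open>The function \<open>?f\<close> has derivative 0 everywhere, and \<open>?f 0 = pi\<close>
  because \<open>erfc 0 = 1\<close>.\<close>

lemma gauss_sinc_eq:
  assumes "\<epsilon> > 0"
  shows "gauss_sinc \<epsilon> t = pi * (1 - erfc (t / (2 * sqrt \<epsilon>)))"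
proof -
  let ?f = "\<lambda>t. gauss_sinc \<epsilon> t + pi * erfc (t / (2 * sqrt \<epsilon>))"
  have "(?f has_real_derivative 0) (at t)" for t
  proof -
    have "((\<lambda>t. erfc (t / (2 * sqrt \<epsilon>))) has_real_derivative
        - (2 / sqrt pi * exp (- (t / (2 * sqrt \<epsilon>))\<^sup>2)) * (1 / (2 * sqrt \<epsilon>))) (at t)"
      by (rule DERIV_chain2[OF DERIV_erfc]) (intro DERIV_cdivide DERIV_ident)
    from DERIV_add[OF DERIV_gauss_sinc[OF assms] DERIV_cmult[OF this, of pi]]
    show ?thesis
    proof (rule DERIV_cong)
      have "(t / (2 * sqrt \<epsilon>))\<^sup>2 = t\<^sup>2 / (4 * \<epsilon>)"
        using assms by (simp add: power_divide power_mult_distrib)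
      moreover have "pi / sqrt pi = sqrt pi"
        by (simp add: real_div_sqrt)
      ultimately show "sqrt (pi / \<epsilon>) * exp (- (t\<^sup>2 / (4 * \<epsilon>))) + pi *
          (- (2 / sqrt pi * exp (- (t / (2 * sqrt \<epsilon>))\<^sup>2)) * (1 / (2 * sqrt \<epsilon>))) = 0"
        using assms by (simp add: real_sqrt_divide field_simps)
    qed
  qed
  then have "?f t = ?f 0"
    using DERIV_isconst_all by blast
  then show ?thesis
    by (simp add: gauss_sinc_def erfc_0 algebra_simps)
qed

lemma pv_inverse_gexp:
  assumes "\<epsilon> > 0"
  shows "pv_inverse (gexp \<epsilon> t) = \<i> * complex_of_real (pi * (1 - erfc (t / (2 * sqrt \<epsilon>))))"
proof -
  have "odd_quot (gexp \<epsilon> t) x = \<i> * complex_of_real (exp (- \<epsilon> * x\<^sup>2) * sin (t * x) / x)" for x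
  proof -
    have "exp (\<i> * complex_of_real (t * x)) - exp (\<i> * complex_of_real (t * (- x))) =
        2 * \<i> * complex_of_real (sin (t * x))"
      by (simp add: complex_eq_iff Re_exp Im_exp)
    then show ?thesis
      unfolding odd_quot_def gexp_polar power2_minus right_diff_distrib[symmetric] by simp
  qed
  moreover have "schwartz (gexp \<epsilon> t)"
    using schwartz_poly_gexp[OF assms, of 1 t] by simp
  ultimately show ?thesis
    by (simp add: pv_inverse_eq integral_complex_of_real gauss_sinc_def flip: gauss_sinc_eq[OF assms] del: of_real_mult of_real_divide)
qed


section \<open>Pairings with polynomials times Gaussians\<close>

text \<open>Inherited from the oddness of the sine integral in \<open>t\<close>, read at
  \<open>\<epsilon> = 1\<close>.\<close>

lemma erfc_minus: "erfc (- x) = 2 - erfc x"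
proof -
  have "gauss_sinc 1 (- (2 * x)) = - gauss_sinc 1 (2 * x)"
    by (simp add: gauss_sinc_def)
  then have "pi * (1 - erfc (- x)) = - (pi * (1 - erfc x))"
    by (simp add: gauss_sinc_eq)
  also have "\<dots> = pi * (- (1 - erfc x))"
    by (rule mult_minus_right[symmetric])
  finally show ?thesis
    unfolding mult_cancel_left by simp
qed

section \<open>Recursions for the moments and for the pairings with T\<close>

context
  fixes \<epsilon> t :: real
  assumes \<epsilon>: "\<epsilon> > 0"
begin

definition moment :: "complex poly \<Rightarrow> complex" where
  "moment p = (LINT x|lborel. poly p (complex_of_real x) * gexp \<epsilon> t x)"

definition pv_moment :: "complex \<Rightarrow> complex poly \<Rightarrow> complex" where
  "pv_moment s p = pv_delta s (\<lambda>x. poly p (complex_of_real x) * gexp \<epsilon> t x)"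

lemma moment_plus: "moment (p + q) = moment p + moment q"
  using schwartz_integrable[OF schwartz_poly_gexp[OF \<epsilon>]]
  by (simp add: moment_def distrib_right)

lemma moment_smult: "moment (smult c p) = c * moment p"
  by (simp add: moment_def mult.assoc)

lemma moment_pderiv: "moment (pderiv p + gvar \<epsilon> t * p) = 0"
  using integral_deriv_schwartz[OF schwartz_poly_gexp[OF \<epsilon>, of p t]] nth_deriv_poly_gexp[of 1 p \<epsilon> t]
  by (simp add: moment_def)

lemma moment_1: "moment 1 = complex_of_real (sqrt (pi / \<epsilon>) * exp (- (t\<^sup>2 / (4 * \<epsilon>))))"
  using integral_gexp[OF \<epsilon>, of t] by (simp add: moment_def)

lemma moment_gvar: "moment (gvar \<epsilon> t) = 0"
  using moment_pderiv[of 1] by simp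

text \<open>Integration by parts applied to \<open>gvar \<epsilon> t ^ Suc i\<close>, whose factor
  has derivative \<open>-2 * \<epsilon>\<close>.\<close>

lemma moment_gvar_power_Suc_Suc:
  "moment (gvar \<epsilon> t ^ Suc (Suc i)) = 2 * complex_of_real \<epsilon> * of_nat (Suc i) * moment (gvar \<epsilon> t ^ i)"
proof -
  have "pderiv (gvar \<epsilon> t ^ Suc i) = smult (of_nat (Suc i) * (2 * (- complex_of_real \<epsilon>))) (gvar \<epsilon> t ^ i)"
    by (subst pderiv_power_Suc) (simp add: gvar_def pderiv_pCons mult.commute)
  then show ?thesis
    using moment_pderiv[of "gvar \<epsilon> t ^ Suc i"]
    by (simp add: moment_plus moment_smult algebra_simps)
qed

lemma moment_gvar_odd: "moment (gvar \<epsilon> t ^ (2 * l + 1)) = 0"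
proof (induction l)
  case (Suc l)
  then show ?case
    using moment_gvar_power_Suc_Suc[of "2 * l + 1"] by simp
qed (simp add: moment_gvar)

lemma moment_gvar_even:
  "moment (gvar \<epsilon> t ^ (2 * l)) =
    (2 * complex_of_real \<epsilon>) ^ l * of_int (double_fact (2 * int l - 1)) * moment 1"
proof (induction l)
  case (Suc l)
  then show ?case
    using moment_gvar_power_Suc_Suc[of "2 * l"] unfolding double_fact_odd_Suc by simp
qed (simp add: double_fact_minus_1)

lemma pv_moment_plus: "pv_moment s (p + q) = pv_moment s p + pv_moment s q"
  using pv_delta_plus[OF schwartz_poly_gexp[OF \<epsilon>, of p] schwartz_poly_gexp[OF \<epsilon>, of q], of s t t]
  by (simp add: pv_moment_def distrib_right)

lemma pv_moment_smult: "pv_moment s (smult c p) = c * pv_moment s p"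
  using pv_delta_cmult[OF schwartz_poly_gexp[OF \<epsilon>, of p], of s c t]
  by (simp add: pv_moment_def mult.assoc)

lemma pv_moment_sum: "pv_moment s (\<Sum>i\<in>A. p i) = (\<Sum>i\<in>A. pv_moment s (p i))"
proof -
  have "pv_moment s 0 = 0"
    using pv_moment_smult[of s 0 0] by simp
  then show ?thesis
    by (induction A rule: infinite_finite_induct) (simp_all add: pv_moment_plus)
qed

lemma pv_moment_pCons_0: "pv_moment s (pCons 0 p) = moment p"
  using pv_delta_times_id[OF schwartz_poly_gexp[OF \<epsilon>, of p t], of s]
    schwartz_poly_gexp[OF \<epsilon>, of "pCons 0 p" t]
  by (simp add: pv_moment_def moment_def mult.assoc)

text \<open>The constant term of \<open>gvar\<close> multiplies the pairing, while its linear term,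
  by x T = 1, leaves only an ordinary moment.\<close>

lemma pv_moment_gvar_mult:
  "pv_moment s (gvar \<epsilon> t * p) = \<i> * complex_of_real t * pv_moment s p - 2 * complex_of_real \<epsilon> * moment p"
proof -
  have "gvar \<epsilon> t * p = smult (\<i> * complex_of_real t) p + smult (- (2 * complex_of_real \<epsilon>)) (pCons 0 p)"
    by (simp add: gvar_def)
  then show ?thesis
    by (simp only: pv_moment_plus pv_moment_smult pv_moment_pCons_0) simp
qed

text \<open>Each induction step uses the recursion twice. The odd moment met on the way is zero, so
  only even moments, hence odd double factorials, survive.\<close>

lemma pv_moment_gvar_odd:
  "pv_moment s (gvar \<epsilon> t ^ (2 * r + 1)) = (\<i> * complex_of_real t) ^ (2 * r + 1) * pv_moment s 1 -
    2 * complex_of_real \<epsilon> * moment 1 *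
    (\<Sum>l=0..r. (\<i> * complex_of_real t) ^ (2 * (r - l)) *
      ((2 * complex_of_real \<epsilon>) ^ l * of_int (double_fact (2 * int l - 1))))"
proof (induction r)
  case 0
  then show ?case
    using pv_moment_gvar_mult[of s 1] by (simp add: double_fact_minus_1)
next
  case (Suc r)
  let ?b = "\<i> * complex_of_real t"
  let ?c = "\<lambda>l. (2 * complex_of_real \<epsilon>) ^ l * of_int (double_fact (2 * int l - 1))"
  have shift: "?b\<^sup>2 * (\<Sum>l=0..r. ?b ^ (2 * (r - l)) * ?c l) = (\<Sum>l=0..r. ?b ^ (2 * (Suc r - l)) * ?c l)"
    unfolding sum_distrib_left
  proof (rule sum.cong)
    fix l assume "l \<in> {0..r}"
    then have "2 * (Suc r - l) = 2 + 2 * (r - l)" by auto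
    then show "?b\<^sup>2 * (?b ^ (2 * (r - l)) * ?c l) = ?b ^ (2 * (Suc r - l)) * ?c l"
      by (simp only: power_add mult.assoc)
  qed simp
  have "pv_moment s (gvar \<epsilon> t ^ (2 * Suc r + 1)) =
      pv_moment s (gvar \<epsilon> t * (gvar \<epsilon> t * gvar \<epsilon> t ^ (2 * r + 1)))"
    by simp
  also have "\<dots> = ?b * (?b * pv_moment s (gvar \<epsilon> t ^ (2 * r + 1)) - 2 * complex_of_real \<epsilon> * moment (gvar \<epsilon> t ^ (2 * r + 1)))
      - 2 * complex_of_real \<epsilon> * moment (gvar \<epsilon> t ^ (2 * Suc r))"
    unfolding pv_moment_gvar_mult by (simp add: mult.assoc)
  also have "\<dots> = ?b\<^sup>2 * pv_moment s (gvar \<epsilon> t ^ (2 * r + 1)) - 2 * complex_of_real \<epsilon> * (?c (Suc r) * moment 1)"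
    unfolding moment_gvar_odd moment_gvar_even by (simp add: power2_eq_square)
  also have "\<dots> = ?b ^ (2 * Suc r + 1) * pv_moment s 1 - 2 * complex_of_real \<epsilon> * moment 1 *
      (?b\<^sup>2 * (\<Sum>l=0..r. ?b ^ (2 * (r - l)) * ?c l) + ?c (Suc r))"
    unfolding Suc by (simp add: algebra_simps power2_eq_square)
  also have "?b\<^sup>2 * (\<Sum>l=0..r. ?b ^ (2 * (r - l)) * ?c l) + ?c (Suc r) =
      (\<Sum>l=0..Suc r. ?b ^ (2 * (Suc r - l)) * ?c l)"
    unfolding shift by simp
  finally show ?case .
qed

text \<open>The derivative is expanded in odd powers of \<open>gvar\<close> and paired term by term.
  The coefficients of \<open>pv_moment s 1\<close> recombine, by the same expansion read backwards,
  into \<open>gauss_poly\<close> at \<open>\<i> * t\<close>.\<close>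

lemma pv_delta_nth_deriv_gexp:
  "pv_delta s (nth_deriv (2 * N + 1) (gexp \<epsilon> t)) / fact (2 * N + 1) =
    gauss_poly (- complex_of_real \<epsilon>) (2 * N + 1) (\<i> * complex_of_real t) / fact (2 * N + 1) * pv_delta s (gexp \<epsilon> t)
    - 2 * complex_of_real \<epsilon> * moment 1 *
    (\<Sum>m=0..N. (- complex_of_real \<epsilon>) ^ m / (fact m * fact (2 * N + 1 - 2 * m)) *
      (\<Sum>l=0..N-m. (\<i> * complex_of_real t) ^ (2 * (N - m - l)) *
        ((2 * complex_of_real \<epsilon>) ^ l * of_int (double_fact (2 * int l - 1)))))"
proof -
  let ?c = "\<lambda>m. (- complex_of_real \<epsilon>) ^ m / (fact m * fact (2 * N + 1 - 2 * m))"
  let ?b = "\<i> * complex_of_real t"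
  let ?S = "\<lambda>m. \<Sum>l=0..N-m. ?b ^ (2 * (N - m - l)) *
        ((2 * complex_of_real \<epsilon>) ^ l * of_int (double_fact (2 * int l - 1)))"
  have "nth_deriv (2 * N + 1) (gexp \<epsilon> t) = (\<lambda>x. poly (smult (fact (2 * N + 1))
      (\<Sum>m=0..N. smult (?c m) (gvar \<epsilon> t ^ (2 * N + 1 - 2 * m)))) (complex_of_real x) * gexp \<epsilon> t x)"
    unfolding nth_deriv_gexp gauss_poly_odd_explicit by (simp only: poly_smult poly_sum poly_power)
  then have "pv_delta s (nth_deriv (2 * N + 1) (gexp \<epsilon> t)) =
      pv_moment s (smult (fact (2 * N + 1)) (\<Sum>m=0..N. smult (?c m) (gvar \<epsilon> t ^ (2 * N + 1 - 2 * m))))"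
    by (simp only: pv_moment_def)
  also have "\<dots> = fact (2 * N + 1) * (\<Sum>m=0..N. ?c m * pv_moment s (gvar \<epsilon> t ^ (2 * N + 1 - 2 * m)))"
    by (simp only: pv_moment_smult pv_moment_sum)
  finally have "pv_delta s (nth_deriv (2 * N + 1) (gexp \<epsilon> t)) / fact (2 * N + 1) =
      (\<Sum>m=0..N. ?c m * pv_moment s (gvar \<epsilon> t ^ (2 * N + 1 - 2 * m)))"
    by (simp only: nonzero_mult_div_cancel_left[OF fact_nonzero])
  also have "\<dots> = (\<Sum>m=0..N. ?c m * (?b ^ (2 * N + 1 - 2 * m) * pv_moment s 1
      - 2 * complex_of_real \<epsilon> * moment 1 * ?S m))"
  proof (intro sum.cong refl)
    fix m assume "m \<in> {0..N}"
    then have "2 * N + 1 - 2 * m = 2 * (N - m) + 1" by auto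
    then show "?c m * pv_moment s (gvar \<epsilon> t ^ (2 * N + 1 - 2 * m)) =
        ?c m * (?b ^ (2 * N + 1 - 2 * m) * pv_moment s 1 - 2 * complex_of_real \<epsilon> * moment 1 * ?S m)"
      by (simp only: pv_moment_gvar_odd)
  qed
  also have "\<dots> = (\<Sum>m=0..N. ?c m * ?b ^ (2 * N + 1 - 2 * m)) * pv_moment s 1
      - 2 * complex_of_real \<epsilon> * moment 1 * (\<Sum>m=0..N. ?c m * ?S m)"
    unfolding right_diff_distrib sum_subtractf sum_distrib_left sum_distrib_right
    by (intro arg_cong2[of _ _ _ _ "(-)"] sum.cong refl) (simp_all only: ac_simps)
  also have "(\<Sum>m=0..N. ?c m * ?b ^ (2 * N + 1 - 2 * m)) =
      gauss_poly (- complex_of_real \<epsilon>) (2 * N + 1) ?b / fact (2 * N + 1)"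
    unfolding gauss_poly_odd_explicit by (simp only: nonzero_mult_div_cancel_left[OF fact_nonzero])
  also have "pv_moment s 1 = pv_delta s (gexp \<epsilon> t)"
    by (simp add: pv_moment_def)
  finally show ?thesis .
qed

end

section \<open>Identification of the double sum with \<open>P_fun\<close> and of the Hermite factor
  with \<open>Q'_fun\<close>\<close>

lemma sum_triangle_reindex:
  fixes a :: "nat \<Rightarrow> nat \<Rightarrow> 'a :: comm_monoid_add"
  shows "(\<Sum>m=0..N. \<Sum>l=0..N-m. a m l) = (\<Sum>k=0..N. \<Sum>m=0..k. a m (k - m))"
proof (induction N)
  case (Suc N)
  have "(\<Sum>m=0..Suc N. \<Sum>l=0..Suc N-m. a m l) = (\<Sum>m=0..N. \<Sum>l=0..Suc N-m. a m l) + a (Suc N) 0"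
    by simp
  also have "(\<Sum>m=0..N. \<Sum>l=0..Suc N-m. a m l) = (\<Sum>m=0..N. (\<Sum>l=0..N-m. a m l) + a m (Suc N - m))"
    by (intro sum.cong) (auto simp: Suc_diff_le)
  finally show ?case
    by (simp add: sum.distrib Suc add.assoc)
qed simp

text \<open>Here \<open>k = m + l\<close> and \<open>N = k + j\<close>. Of the \<open>N\<close>
  factors \<open>- (2 * pi)\<^sup>2\<close>, \<open>k\<close> meet
  \<open>- (\<epsilon> / (2 * pi\<^sup>2))\<close> and give \<open>2 * \<epsilon>\<close>, while
  \<open>j\<close> meet \<open>p\<^sup>2\<close>; the one remaining \<open>2 * pi\<close> joins the
  square root.\<close>

lemma P_fun_coefficient:
  fixes \<epsilon> p :: real
  assumes "\<epsilon> > 0" "m \<le> k" "k \<le> N"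
  shows "- (2 * \<epsilon> * sqrt (pi / \<epsilon>)) * ((- \<epsilon>) ^ m * (- (2 * pi * p)\<^sup>2) ^ (N - k) * (2 * \<epsilon>) ^ (k - m)) =
    (-1) ^ (N + 1) * (2 * pi) ^ (2 * N + 1) * sqrt (\<epsilon> / pi) *
    ((- (\<epsilon> / (2 * pi\<^sup>2))) ^ k * p ^ (2 * N - 2 * k) * ((-1) ^ m / 2 ^ m))"
proof -
  obtain j where N: "N = k + j" using assms(3) le_Suc_ex by blast
  obtain l where k: "k = m + l" using assms(2) le_Suc_ex by blast
  have root: "\<epsilon> * sqrt (pi / \<epsilon>) = pi * sqrt (\<epsilon> / pi)"
    using assms(1) by (simp add: real_sqrt_divide real_div_sqrt field_simps)
  have "(-1) ^ (k + j) * a ^ (2 * (k + j)) * (b ^ k * p ^ (2 * j)) =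
      ((-1) * a\<^sup>2 * b) ^ k * ((-1) * a\<^sup>2 * p\<^sup>2) ^ j" for a b :: real
    by (simp only: power_add power_mult power_mult_distrib) (simp only: ac_simps)
  then have "(-1) ^ (k + j) * (2 * pi) ^ (2 * (k + j)) * ((- (\<epsilon> / (2 * pi\<^sup>2))) ^ k * p ^ (2 * j)) =
      ((-1) * (2 * pi)\<^sup>2 * (- (\<epsilon> / (2 * pi\<^sup>2)))) ^ k * ((-1) * (2 * pi)\<^sup>2 * p\<^sup>2) ^ j"
    by (simp only:)
  also have "(-1) * (2 * pi)\<^sup>2 * (- (\<epsilon> / (2 * pi\<^sup>2))) = 2 * \<epsilon>"
    by (simp add: power_mult_distrib)
  also have "(-1) * (2 * pi)\<^sup>2 * p\<^sup>2 = - (2 * pi * p)\<^sup>2"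
    by (simp add: power_mult_distrib)
  finally have *: "(-1) ^ (k + j) * (2 * pi) ^ (2 * (k + j)) * ((- (\<epsilon> / (2 * pi\<^sup>2))) ^ k * p ^ (2 * j)) =
      (2 * \<epsilon>) ^ k * (- (2 * pi * p)\<^sup>2) ^ j" .
  have **: "(2 * \<epsilon>) ^ k * ((-1) ^ m / 2 ^ m) = (- \<epsilon>) ^ m * (2 * \<epsilon>) ^ l"
    unfolding k power_add by (simp add: power_mult_distrib power_minus[of \<epsilon>])
  have "(-1) ^ (N + 1) * (2 * pi) ^ (2 * N + 1) * sqrt (\<epsilon> / pi) *
      ((- (\<epsilon> / (2 * pi\<^sup>2))) ^ k * p ^ (2 * N - 2 * k) * ((-1) ^ m / 2 ^ m)) =
      - (2 * (pi * sqrt (\<epsilon> / pi))) * ((-1) ^ (k + j) * (2 * pi) ^ (2 * (k + j)) *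
      ((- (\<epsilon> / (2 * pi\<^sup>2))) ^ k * p ^ (2 * j))) * ((-1) ^ m / 2 ^ m)"
    by (simp add: N)
  also have "\<dots> = - (2 * (pi * sqrt (\<epsilon> / pi))) * ((2 * \<epsilon>) ^ k * ((-1) ^ m / 2 ^ m)) * (- (2 * pi * p)\<^sup>2) ^ j"
    unfolding * by (simp only: ac_simps)
  also have "\<dots> = - (2 * (\<epsilon> * sqrt (pi / \<epsilon>))) * ((- \<epsilon>) ^ m * (2 * \<epsilon>) ^ l) * (- (2 * pi * p)\<^sup>2) ^ j"
    unfolding ** root ..
  finally show ?thesis
    by (simp add: N k)
qed

lemma P_fun_eq:
  assumes "\<epsilon> > 0"
  shows "P_fun (N + 2) \<epsilon> p = - (2 * \<epsilon> * sqrt (pi / \<epsilon>)) *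
    (\<Sum>m=0..N. (- \<epsilon>) ^ m / (fact m * fact (2 * N + 1 - 2 * m)) *
      (\<Sum>l=0..N-m. (- (2 * pi * p)\<^sup>2) ^ (N - m - l) *
        ((2 * \<epsilon>) ^ l * of_int (double_fact (2 * int l - 1)))))"
proof -
  let ?C = "- (2 * \<epsilon> * sqrt (pi / \<epsilon>))"
  let ?D = "(-1) ^ (N + 1) * (2 * pi) ^ (2 * N + 1) * sqrt (\<epsilon> / pi)"
  let ?d = "\<lambda>k m. real_of_int (double_fact (2 * int k - 2 * int m - 1)) / (fact m * fact (2 * N + 1 - 2 * m))"
  have "?C * (\<Sum>m=0..N. (- \<epsilon>) ^ m / (fact m * fact (2 * N + 1 - 2 * m)) *
      (\<Sum>l=0..N-m. (- (2 * pi * p)\<^sup>2) ^ (N - m - l) *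
        ((2 * \<epsilon>) ^ l * of_int (double_fact (2 * int l - 1))))) =
    (\<Sum>m=0..N. \<Sum>l=0..N-m. ?C * ((- \<epsilon>) ^ m / (fact m * fact (2 * N + 1 - 2 * m)) *
      ((- (2 * pi * p)\<^sup>2) ^ (N - m - l) * ((2 * \<epsilon>) ^ l * of_int (double_fact (2 * int l - 1))))))"
    unfolding sum_distrib_left ..
  also have "\<dots> = (\<Sum>k=0..N. \<Sum>m=0..k. ?C * ((- \<epsilon>) ^ m / (fact m * fact (2 * N + 1 - 2 * m)) *
      ((- (2 * pi * p)\<^sup>2) ^ (N - m - (k - m)) *
        ((2 * \<epsilon>) ^ (k - m) * of_int (double_fact (2 * int (k - m) - 1))))))"
    by (rule sum_triangle_reindex)
  also have "\<dots> = (\<Sum>k=0..N. \<Sum>m=0..k. ?D * ((- (\<epsilon> / (2 * pi\<^sup>2))) ^ k * p ^ (2 * N - 2 * k) *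
      ((-1) ^ m / 2 ^ m)) * ?d k m)"
  proof (intro sum.cong refl)
    fix k m assume "k \<in> {0..N}" "m \<in> {0..k}"
    then have le: "m \<le> k" "k \<le> N" by auto
    then have "N - m - (k - m) = N - k" "2 * int (k - m) - 1 = 2 * int k - 2 * int m - 1" by auto
    then show "?C * ((- \<epsilon>) ^ m / (fact m * fact (2 * N + 1 - 2 * m)) *
        ((- (2 * pi * p)\<^sup>2) ^ (N - m - (k - m)) *
          ((2 * \<epsilon>) ^ (k - m) * of_int (double_fact (2 * int (k - m) - 1))))) =
        ?D * ((- (\<epsilon> / (2 * pi\<^sup>2))) ^ k * p ^ (2 * N - 2 * k) * ((-1) ^ m / 2 ^ m)) * ?d k m"
      unfolding P_fun_coefficient[OF assms le, symmetric] by simp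
  qed
  also have "\<dots> = P_fun (N + 2) \<epsilon> p"
    unfolding P_fun_def sum_distrib_left by (intro sum.cong) auto
  finally show ?thesis ..
qed

lemma gauss_poly_odd_0: "odd n \<Longrightarrow> gauss_poly a n 0 = 0"
  using gauss_poly_scale[of "-1" a n 0] by simp

text \<open>The power of \<open>\<epsilon>\<close> in \<open>Q'_fun\<close> is
  \<open>sqrt \<epsilon> ^ (2 * N + 1)\<close>, exactly the factor produced by
  \<open>gauss_poly_scale\<close> when the parameter changes from -1 to
  \<open>- \<epsilon>\<close>.\<close>

lemma Q'_fun_eq:
  assumes "\<epsilon> > 0"
  shows "Q'_fun (N + 2) \<epsilon> p = \<i> * complex_of_real pi / fact (2 * N + 1) *
    gauss_poly (- complex_of_real \<epsilon>) (2 * N + 1) (\<i> * complex_of_real (2 * pi * p))"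
proof -
  let ?n = "2 * N + 1" and ?c = "complex_of_real (sqrt \<epsilon>)"
  have "\<epsilon> powr (real (N + 2) - 3 / 2) = (\<epsilon> powr (1 / 2)) powr real ?n"
    by (simp add: powr_powr field_simps)
  also have "\<dots> = sqrt \<epsilon> ^ ?n"
    using assms by (simp only: powr_half_sqrt powr_realpow real_sqrt_gt_zero less_imp_le)
  finally have pow: "complex_of_real (\<epsilon> powr (real (N + 2) - 3 / 2)) = ?c ^ ?n"
    by simp
  have "gauss_poly (- complex_of_real \<epsilon>) ?n (\<i> * complex_of_real (2 * pi * p)) =
      gauss_poly (?c\<^sup>2 * (-1)) ?n (?c * (2 * (\<i> * complex_of_real (pi * p / sqrt \<epsilon>))))"
    using assms by (simp add: mult.assoc mult.left_commute flip: of_real_power)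
  also have "\<dots> = ?c ^ ?n * hermite ?n (\<i> * complex_of_real (pi * p / sqrt \<epsilon>))"
    by (simp only: gauss_poly_scale hermite_eq_gauss_poly)
  finally show ?thesis
    unfolding Q'_fun_def of_real_mult pow by simp
qed

text \<open>The principal value alone gives an error function, odd in \<open>m\<close>. The delta
  term shifts it by the sign of \<open>m\<close>, and reflection of \<open>erfc\<close> turns the
  result into one at \<open>\<bar>m\<bar>\<close>.\<close>

lemma pv_delta_gexp:
  assumes "\<epsilon> > 0"
  shows "pv_delta (of_int (sgn m)) (gexp \<epsilon> (- (2 * pi * real_of_int m))) =
    \<i> * complex_of_real pi * of_int (sgn m) * complex_of_real (erfc (pi * \<bar>real_of_int m\<bar> / sqrt \<epsilon>))"
proof -
  have eq: "- (2 * pi * real_of_int m) / (2 * sqrt \<epsilon>) = - (pi * real_of_int m / sqrt \<epsilon>)"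
    by simp
  show ?thesis
    unfolding pv_delta_def pv_inverse_gexp[OF assms] dirac_delta_def eq
    by (cases m "0 :: int" rule: linorder_cases) (simp_all add: erfc_minus erfc_0 algebra_simps)
qed

section \<open>Assembly of the pairing and comparison with \<open>H_fun\<close>\<close>

theorem mainTheorem2:
  fixes g :: nat and \<epsilon> :: real and m :: int
  assumes "g \<ge> 2" and "\<epsilon> > 0"
  defines "\<psi> \<equiv> (\<lambda>\<phi>::real. exp (complex_of_real (- \<epsilon> * \<phi>\<^sup>2) -
                      2 * complex_of_real pi * \<i> * of_int m * complex_of_real \<phi>))"
  shows "tempered_distribution (Delta g m) \<and> schwartz \<psi> \<and>
         H_fun g \<epsilon> \<bar>real_of_int m\<bar> = Delta g m \<psi>"
proof (intro conjI)
  show "tempered_distribution (Delta g m)"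
    by (rule tempered_distribution_Delta[OF assms(1)])
  define t where "t = - (2 * pi * real_of_int m)"
  have \<psi>: "\<psi> = gexp \<epsilon> t"
    by (rule ext) (simp add: \<psi>_def gexp_def t_def algebra_simps)
  show "schwartz \<psi>"
    using schwartz_poly_gexp[OF assms(2), of 1 t] by (simp add: \<psi>)
  define N where "N = g - 2"
  have g: "g = N + 2" "2 * g - 3 = 2 * N + 1"
    using assms(1) by (auto simp: N_def)
  define p where "p = \<bar>real_of_int m\<bar>"
  have t2: "t\<^sup>2 = (2 * pi * p)\<^sup>2"
    by (simp add: t_def p_def power_mult_distrib)
  note Q' = Q'_fun_eq[OF assms(2), of N p, folded g(1)]
  \<comment> \<open>The polynomial is odd, so \<open>sgn m\<close> changes its argument from
    \<open>t\<close> to \<open>2 * pi * p\<close>, with a minus sign because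
    \<open>t = - 2 * pi * m\<close>. For \<open>m = 0\<close> both sides vanish.\<close>
  have Q: "gauss_poly (- complex_of_real \<epsilon>) (2 * N + 1) (\<i> * complex_of_real t) / fact (2 * N + 1) *
      (\<i> * complex_of_real pi * of_int (sgn m)) = - Q'_fun g \<epsilon> p"
  proof (cases m "0 :: int" rule: linorder_cases)
    case less
    then have "t = 2 * pi * p" by (simp add: t_def p_def)
    then show ?thesis
      using less by (simp add: Q')
  next
    case equal
    then have "t = 0" "p = 0" by (simp_all add: t_def p_def)
    then show ?thesis
      using equal Q' by (simp add: gauss_poly_odd_0)
  next
    case greater
    then have "\<i> * complex_of_real t = (-1) * (\<i> * complex_of_real (2 * pi * p))"
      by (simp add: t_def p_def)
    then have "gauss_poly (- complex_of_real \<epsilon>) (2 * N + 1) (\<i> * complex_of_real t) =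
        - gauss_poly (- complex_of_real \<epsilon>) (2 * N + 1) (\<i> * complex_of_real (2 * pi * p))"
      using gauss_poly_scale[of "-1" "- complex_of_real \<epsilon>" "2 * N + 1" "\<i> * complex_of_real (2 * pi * p)"]
      by simp
    then show ?thesis
      using greater by (simp add: Q')
  qed
  \<comment> \<open>Only even powers of \<open>\<i> * t\<close> enter the double sum, so it is real
    and depends on \<open>m\<close> through \<open>p\<close> alone.\<close>
  have pow: "(\<i> * complex_of_real t) ^ (2 * r) = complex_of_real ((- (2 * pi * p)\<^sup>2) ^ r)" for r
    unfolding power_mult power_mult_distrib[of \<i>] by (simp flip: t2)
  have "- (2 * complex_of_real \<epsilon> * moment \<epsilon> t 1 *
    (\<Sum>m=0..N. (- complex_of_real \<epsilon>) ^ m / (fact m * fact (2 * N + 1 - 2 * m)) *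
      (\<Sum>l=0..N-m. (\<i> * complex_of_real t) ^ (2 * (N - m - l)) *
        ((2 * complex_of_real \<epsilon>) ^ l * of_int (double_fact (2 * int l - 1)))))) =
    complex_of_real (exp (- (t\<^sup>2 / (4 * \<epsilon>))) * P_fun g \<epsilon> p)"
    unfolding moment_1[OF assms(2)] pow g(1) P_fun_eq[OF assms(2)] by simp
  moreover have "t\<^sup>2 / (4 * \<epsilon>) = pi\<^sup>2 * p\<^sup>2 / \<epsilon>"
    unfolding t2 by (simp add: power_mult_distrib)
  ultimately have P: "- (2 * complex_of_real \<epsilon> * moment \<epsilon> t 1 *
    (\<Sum>m=0..N. (- complex_of_real \<epsilon>) ^ m / (fact m * fact (2 * N + 1 - 2 * m)) *
      (\<Sum>l=0..N-m. (\<i> * complex_of_real t) ^ (2 * (N - m - l)) *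
        ((2 * complex_of_real \<epsilon>) ^ l * of_int (double_fact (2 * int l - 1)))))) =
    complex_of_real (exp (- (pi\<^sup>2 * p\<^sup>2 / \<epsilon>)) * P_fun g \<epsilon> p)"
    by (simp only:)
  have "Delta g m \<psi> = gauss_poly (- complex_of_real \<epsilon>) (2 * N + 1) (\<i> * complex_of_real t) / fact (2 * N + 1) *
      (\<i> * complex_of_real pi * of_int (sgn m)) * complex_of_real (erfc (pi * p / sqrt \<epsilon>)) +
      complex_of_real (exp (- (pi\<^sup>2 * p\<^sup>2 / \<epsilon>)) * P_fun g \<epsilon> p)"
    unfolding Delta_eq[OF assms(1)] \<psi> g(2) pv_delta_nth_deriv_gexp[OF assms(2)]
      P[symmetric] pv_delta_gexp[OF assms(2), of m, folded t_def p_def] by (simp add: mult.assoc)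
  then show "H_fun g \<epsilon> \<bar>real_of_int m\<bar> = Delta g m \<psi>"
    unfolding Q by (simp add: H_fun_def p_def)
qed

end
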